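(* Class tables of non-expansive type systems with single instantiation inheritance describe exactly the deterministic regular forests: $\mathcal{L}(\mathcal{T}_{\emptyset})=\mathcal{L}(\mathcal{T}_{\{C\}})=\mathrm{DRF}$.
   Context: Terms. A ranked alphabet is a finite set of symbols, each with a rank in $\mathbb{N}$; $A^{\triangle}$ is the set of finite ground terms (trees) over a ranked alphabet $A$. $X$ is a set of parameters (rank $0$), disjoint from other alphabets; $\tau[\boldsymbol{x}\leftarrow\boldsymbol{t}]$ is simultaneous substitution. Class tables. A class table $\Delta$ over a finite set of class names $\Gamma$ consists of one declaration $\gamma(\diamond_1x_1,\dots,\diamond_kx_k):\tau_1,\dots,\tau_m$ ($k,m\ge 0$) for each $\gamma\in\Gamma$, where $k$ is the rank of $\gamma$, the $x_i\in X$ are distinct, $\diamond_i\in\{\circ,+,-\}$ (invariant, covariant, contravariant) is the variance of the $i$-th parameter of $\gamma$, denoted $\mathrm{var}_i(\gamma)$, and the supertypes $\tau_j$ are terms over $\Gamma\cup\{x_1,\dots,x_k\}$, none of which is itself a parameter. Ground types are elements of $\Gamma^{\triangle}$. We write $\gamma(\boldsymbol{x}):\tau$ if $\tau$ is one of the declared supertypes of $\gamma$. Inheritance. $\gamma(\boldsymbol{t})\rightarrowtail\tau[\boldsymbol{x}\leftarrow\boldsymbol{t}]$ whenever $\gamma(\boldsymbol{x}):\tau$. Class inheritance closure $:^*$ is the least relation with $\gamma(\boldsymbol{x}):^*\gamma(\boldsymbol{x})$, and $\gamma(\boldsymbol{x}):^*\tau[\boldsymbol{x}'\leftarrow\boldsymbol{\tau}]$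 whenever $\gamma(\boldsymbol{x}):\gamma'(\boldsymbol{\tau})$ and $\gamma'(\boldsymbol{x}'):^*\tau$; $:^+$ and $\rightarrowtail^+$ are the transitive, non-reflexive versions (one or more steps). Subtyping. $<:$ is the least relation on ground types closed under: (Var) $\gamma(t_1,\dots,t_k)<:\gamma(t_1',\dots,t_k')$ if for every $i$: $t_i<:t_i'$ when $\mathrm{var}_i(\gamma)=+$, $t_i=t_i'$ when $\mathrm{var}_i(\gamma)=\circ$, and $t_i'<:t_i$ when $\mathrm{var}_i(\gamma)=-$; (Super) $t<:t''$ if $t\rightarrowtail t'$ and $t'<:t''$. Well-formedness. $\Delta$ is well-formed if (acyclic inheritance) $\gamma(\boldsymbol{\tau})\rightarrowtail^+\gamma'(\boldsymbol{\tau}')$ implies $\gamma\ne\gamma'$; and (valid variance) for each declaration $\gamma(\boldsymbol{\diamond x}):\tau_1,\dots,\tau_m$, $\boldsymbol{\diamond x}\vdash\tau_j$ for all $j$, where $\boldsymbol{\diamond x}\vdash x_i$ iff $\diamond_i\in\{\circ,+\}$, and $\boldsymbol{\diamond x}\vdash\gamma'(\tau'_1,\dots,\tau'_n)$ iff for all $i$: $\mathrm{var}_i(\gamma')\in\{\circ,+\}$ implies $\boldsymbol{\diamond x}\vdash\tau'_i$, and $\mathrm{var}_i(\gamma')\in\{\circ,-\}$ implies $\neg\boldsymbol{\diamond x}\vdash\tau'_i$; here $\neg\boldsymbol{\diamond x}$ swaps $+$ and $-$ and leaves $\circ$ fixed. Features and fragments. A set of ground types is closed under inheritance and decomposition if for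 each $\gamma(\boldsymbol{t})$ in it, it contains all the $t_i$ and all $t'$ with $\gamma(\boldsymbol{t})\rightarrowtail t'$; $\mathrm{cl}(T)$ is the least such set containing $T$. For $S\subseteq\{C,X,M\}$, a class table conforms to the type system $\mathcal{T}_S$, written $\mathcal{T}_S\vdash\Delta$, if it is well-formed and: if $C\notin S$, no parameter is contravariant; if $X\notin S$, $\Delta$ is non-expansive, i.e., $\mathrm{cl}(T)$ is finite for every finite set $T$ of ground types; if $M\notin S$, $\Delta$ has single instantiation inheritance, i.e., $\gamma(\boldsymbol{x}):^+\gamma'(\boldsymbol{\tau})$ and $\gamma(\boldsymbol{x}):^+\gamma'(\boldsymbol{\tau}')$ imply $\boldsymbol{\tau}=\boldsymbol{\tau}'$. Thus $\mathcal{T}_{\{C\}}$ consists of the well-formed, non-expansive class tables with single instantiation inheritance, and $\mathcal{T}_{\emptyset}$ of those among them without contravariant parameters. Languages. For a class table $\Delta$ over $\Gamma$, a ground type $t_\bot\in\Gamma^{\triangle}$ and a super-alphabet $\Sigma_\top\subseteq\Gamma$, $L_{t_\bot}(\Delta)=\{t_\top\in\Sigma_\top^{\triangle}\mid t_\bot<:t_\top\}$. $\mathcal{L}(\mathcal{T}_S)$ is the class of all forests $L_{t_\bot}(\Delta)$ with $\mathcal{T}_S\vdash\Delta$ (over all choices of $\Gamma,\Delta,t_\bot,\Sigma_\top$). Deterministic regular forests. A regular tree grammar is $G=\langle\Sigma,V,v_0,R\rangle$ with $\Sigma$ a finite ranked alphabet, $V$ a finite set of variables of rank $0$ disjoint from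 $\Sigma$, $v_0\in V$, and $R$ a finite set of productions $v::=\sigma(v_1,\dots,v_n)$, $\sigma\in\Sigma$ of rank $n$, $v,v_i\in V$. It is deterministic if whenever $v::=\sigma(\boldsymbol{v})$ and $v::=\sigma(\boldsymbol{v}')$ are both in $R$, $\boldsymbol{v}=\boldsymbol{v}'$. One derivation step replaces one occurrence of $v$ in a tree by the right-hand side of a production for $v$; $L(G)=\{t\in\Sigma^{\triangle}\mid v_0\to_G^*t\}$. DRF is the class of forests $L(G)$, $G$ a deterministic regular tree grammar. *)

theory Defs
  imports Main "HOL-Library.Infinite_Typeclass"
begin

(* A ranked alphabet is a finite set A of symbols together with a rank function rk, of which only
   the values on A matter.  Parameters of class declarations and variables of grammars are the
   Var leaves, hence automatically of rank 0 and disjoint from every alphabet; they are named by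
   natural numbers, which provides as many of them as a finite class table or grammar may need. *)
datatype 'a trm = Var nat | Fun 'a "'a trm list"

type_synonym 'a forest = "'a trm set"

inductive_set terms :: "'a set \<Rightarrow> ('a \<Rightarrow> nat) \<Rightarrow> nat set \<Rightarrow> 'a trm set"
  for A :: "'a set" and rk :: "'a \<Rightarrow> nat" and V :: "nat set" where
  terms_Var: "x \<in> V \<Longrightarrow> Var x \<in> terms A rk V"
| terms_Fun: "\<lbrakk>f \<in> A; length ts = rk f; \<And>t. t \<in> set ts \<Longrightarrow> t \<in> terms A rk V\<rbrakk>
    \<Longrightarrow> Fun f ts \<in> terms A rk V"

abbreviation ground_terms :: "'a set \<Rightarrow> ('a \<Rightarrow> nat) \<Rightarrow> 'a trm set" where
  "ground_terms A rk \<equiv> terms A rk {}"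

primrec subst :: "(nat \<Rightarrow> 'a trm) \<Rightarrow> 'a trm \<Rightarrow> 'a trm" where
  "subst \<sigma> (Var x) = \<sigma> x"
| "subst \<sigma> (Fun f ts) = Fun f (map (subst \<sigma>) ts)"

definition assign :: "nat list \<Rightarrow> 'a trm list \<Rightarrow> nat \<Rightarrow> 'a trm" where
  "assign xs ts x = (case map_of (zip xs ts) x of Some t \<Rightarrow> t | None \<Rightarrow> Var x)"


section \<open>Class tables\<close>

datatype variance = Invariant | Covariant | Contravariant

fun opposite :: "variance \<Rightarrow> variance" where
  "opposite Invariant = Invariant"
| "opposite Covariant = Contravariant"
| "opposite Contravariant = Covariant"

type_synonym params = "(variance \<times> nat) list"

(* The declaration of a class g is  g(params g) : supers g.  The values of params and supers
   outside of classes are irrelevant. *)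
record 'a class_table =
  classes :: "'a set"
  params :: "'a \<Rightarrow> params"
  supers :: "'a \<Rightarrow> 'a trm list"

definition rank :: "'a class_table \<Rightarrow> 'a \<Rightarrow> nat" where
  "rank \<Delta> g = length (params \<Delta> g)"

definition param_names :: "'a class_table \<Rightarrow> 'a \<Rightarrow> nat list" where
  "param_names \<Delta> g = map snd (params \<Delta> g)"

(* Parameter positions are counted from 0. *)
definition var :: "'a class_table \<Rightarrow> 'a \<Rightarrow> nat \<Rightarrow> variance" where
  "var \<Delta> g i = fst (params \<Delta> g ! i)"

definition class_table :: "'a class_table \<Rightarrow> bool" where
  "class_table \<Delta> \<longleftrightarrow> finite (classes \<Delta>) \<and>
     (\<forall>g \<in> classes \<Delta>. distinct (param_names \<Delta> g) \<and>
        (\<forall>\<tau> \<in> set (supers \<Delta> g).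
           \<tau> \<in> terms (classes \<Delta>) (rank \<Delta>) (set (param_names \<Delta> g)) \<and> (\<forall>x. \<tau> \<noteq> Var x)))"

definition ground_types :: "'a class_table \<Rightarrow> 'a trm set" where
  "ground_types \<Delta> = ground_terms (classes \<Delta>) (rank \<Delta>)"

inductive inherits :: "'a class_table \<Rightarrow> 'a trm \<Rightarrow> 'a trm \<Rightarrow> bool" for \<Delta> :: "'a class_table" where
  "\<lbrakk>Fun g ts \<in> ground_types \<Delta>; \<tau> \<in> set (supers \<Delta> g)\<rbrakk>
    \<Longrightarrow> inherits \<Delta> (Fun g ts) (subst (assign (param_names \<Delta> g) ts) \<tau>)"

(* class_inherits \<Delta> g \<tau> stands for  g(x) :* \<tau>  where x are the declared parameters of g. *)
inductive class_inherits :: "'a class_table \<Rightarrow> 'a \<Rightarrow> 'a trm \<Rightarrow> bool" for \<Delta> :: "'a class_table" where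
  class_inherits_refl:
    "g \<in> classes \<Delta> \<Longrightarrow> class_inherits \<Delta> g (Fun g (map Var (param_names \<Delta> g)))"
| class_inherits_step:
    "\<lbrakk>g \<in> classes \<Delta>; Fun g' \<tau>s \<in> set (supers \<Delta> g); class_inherits \<Delta> g' \<tau>\<rbrakk>
      \<Longrightarrow> class_inherits \<Delta> g (subst (assign (param_names \<Delta> g') \<tau>s) \<tau>)"

(* The relation :+ , i.e. one declared inheritance step followed by :* . *)
inductive class_inherits_plus :: "'a class_table \<Rightarrow> 'a \<Rightarrow> 'a trm \<Rightarrow> bool" for \<Delta> :: "'a class_table" where
  "\<lbrakk>g \<in> classes \<Delta>; Fun g' \<tau>s \<in> set (supers \<Delta> g); class_inherits \<Delta> g' \<tau>\<rbrakk>
    \<Longrightarrow> class_inherits_plus \<Delta> g (subst (assign (param_names \<Delta> g') \<tau>s) \<tau>)"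

inductive subtype :: "'a class_table \<Rightarrow> 'a trm \<Rightarrow> 'a trm \<Rightarrow> bool" for \<Delta> :: "'a class_table" where
  subtype_Var:
    "\<lbrakk>Fun g ts \<in> ground_types \<Delta>; Fun g ts' \<in> ground_types \<Delta>;
      \<forall>i < rank \<Delta> g.
        (var \<Delta> g i = Covariant \<longrightarrow> subtype \<Delta> (ts ! i) (ts' ! i)) \<and>
        (var \<Delta> g i = Invariant \<longrightarrow> ts ! i = ts' ! i) \<and>
        (var \<Delta> g i = Contravariant \<longrightarrow> subtype \<Delta> (ts' ! i) (ts ! i))\<rbrakk>
      \<Longrightarrow> subtype \<Delta> (Fun g ts) (Fun g ts')"
| subtype_Super:
    "\<lbrakk>inherits \<Delta> t t'; subtype \<Delta> t' t''\<rbrakk> \<Longrightarrow> subtype \<Delta> t t''"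


section \<open>Well-formedness\<close>

definition acyclic_inheritance :: "'a class_table \<Rightarrow> bool" where
  "acyclic_inheritance \<Delta> \<longleftrightarrow>
     (\<forall>g \<tau>s g' \<tau>s'. (inherits \<Delta>)\<^sup>+\<^sup>+ (Fun g \<tau>s) (Fun g' \<tau>s') \<longrightarrow> g \<noteq> g')"

definition opposite_params :: "params \<Rightarrow> params" where
  "opposite_params = map (map_prod opposite id)"

lemma size_nth_termination [termination_simp]:
  "i < length ts \<Longrightarrow> size (ts ! i) < Suc (size_list size ts)"
  by (meson le_imp_less_Suc nth_mem order_refl size_list_estimation')

(* valid_variance \<Delta> p \<tau> is the judgement  p |- \<tau> ; the recursive call under opposite_params
   negates the variances of p, not the judgement. *)
fun valid_variance :: "'a class_table \<Rightarrow> params \<Rightarrow> 'a trm \<Rightarrow> bool" where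
  "valid_variance \<Delta> p (Var x) \<longleftrightarrow> (Invariant, x) \<in> set p \<or> (Covariant, x) \<in> set p"
| "valid_variance \<Delta> p (Fun g ts) \<longleftrightarrow>
     (\<forall>i \<in> {..<length ts}.
        (var \<Delta> g i \<in> {Invariant, Covariant} \<longrightarrow> valid_variance \<Delta> p (ts ! i)) \<and>
        (var \<Delta> g i \<in> {Invariant, Contravariant} \<longrightarrow>
           valid_variance \<Delta> (opposite_params p) (ts ! i)))"

definition well_formed :: "'a class_table \<Rightarrow> bool" where
  "well_formed \<Delta> \<longleftrightarrow> class_table \<Delta> \<and> acyclic_inheritance \<Delta> \<and>
     (\<forall>g \<in> classes \<Delta>. \<forall>\<tau> \<in> set (supers \<Delta> g). valid_variance \<Delta> (params \<Delta> g) \<tau>)"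


section \<open>Type systems and their languages\<close>

inductive_set cl :: "'a class_table \<Rightarrow> 'a trm set \<Rightarrow> 'a trm set"
  for \<Delta> :: "'a class_table" and T :: "'a trm set" where
  cl_base: "t \<in> T \<Longrightarrow> t \<in> cl \<Delta> T"
| cl_decomposition: "\<lbrakk>Fun g ts \<in> cl \<Delta> T; t \<in> set ts\<rbrakk> \<Longrightarrow> t \<in> cl \<Delta> T"
| cl_inheritance: "\<lbrakk>t \<in> cl \<Delta> T; inherits \<Delta> t t'\<rbrakk> \<Longrightarrow> t' \<in> cl \<Delta> T"

definition non_expansive :: "'a class_table \<Rightarrow> bool" where
  "non_expansive \<Delta> \<longleftrightarrow> (\<forall>T. finite T \<longrightarrow> T \<subseteq> ground_types \<Delta> \<longrightarrow> finite (cl \<Delta> T))"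

definition no_contravariance :: "'a class_table \<Rightarrow> bool" where
  "no_contravariance \<Delta> \<longleftrightarrow>
     (\<forall>g \<in> classes \<Delta>. \<forall>i < rank \<Delta> g. var \<Delta> g i \<noteq> Contravariant)"

definition single_instantiation :: "'a class_table \<Rightarrow> bool" where
  "single_instantiation \<Delta> \<longleftrightarrow>
     (\<forall>g g' \<tau>s \<tau>s'. class_inherits_plus \<Delta> g (Fun g' \<tau>s) \<longrightarrow>
        class_inherits_plus \<Delta> g (Fun g' \<tau>s') \<longrightarrow> \<tau>s = \<tau>s')"

(* The features C, X and M, in this order. *)
datatype feature = Contravariance | Expansiveness | Multiple_Instantiation

definition conforms :: "feature set \<Rightarrow> 'a class_table \<Rightarrow> bool" where
  "conforms S \<Delta> \<longleftrightarrow> well_formed \<Delta> \<and>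
     (Contravariance \<notin> S \<longrightarrow> no_contravariance \<Delta>) \<and>
     (Expansiveness \<notin> S \<longrightarrow> non_expansive \<Delta>) \<and>
     (Multiple_Instantiation \<notin> S \<longrightarrow> single_instantiation \<Delta>)"

definition subtype_language :: "'a class_table \<Rightarrow> 'a trm \<Rightarrow> 'a set \<Rightarrow> 'a forest" where
  "subtype_language \<Delta> t\<^sub>0 A = {t \<in> ground_terms A (rank \<Delta>). subtype \<Delta> t\<^sub>0 t}"

definition languages :: "feature set \<Rightarrow> 'a forest set" where
  "languages S = {subtype_language \<Delta> t\<^sub>0 A | \<Delta> t\<^sub>0 A.
     conforms S \<Delta> \<and> t\<^sub>0 \<in> ground_types \<Delta> \<and> A \<subseteq> classes \<Delta>}"


section \<open>Deterministic regular forests\<close>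

(* A production  v ::= f(vs)  is the triple (v, f, vs). *)
record 'a grammar =
  symbols :: "'a set"
  symbol_rank :: "'a \<Rightarrow> nat"
  variables :: "nat set"
  start :: nat
  productions :: "(nat \<times> 'a \<times> nat list) set"

definition regular_tree_grammar :: "'a grammar \<Rightarrow> bool" where
  "regular_tree_grammar G \<longleftrightarrow>
     finite (symbols G) \<and> finite (variables G) \<and> start G \<in> variables G \<and>
     finite (productions G) \<and>
     (\<forall>(v, f, vs) \<in> productions G. v \<in> variables G \<and> f \<in> symbols G \<and>
        length vs = symbol_rank G f \<and> set vs \<subseteq> variables G)"

definition deterministic :: "'a grammar \<Rightarrow> bool" where
  "deterministic G \<longleftrightarrow>
     (\<forall>v f vs vs'. (v, f, vs) \<in> productions G \<longrightarrow> (v, f, vs') \<in> productions G \<longrightarrow> vs = vs')"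

inductive derives :: "'a grammar \<Rightarrow> 'a trm \<Rightarrow> 'a trm \<Rightarrow> bool" for G :: "'a grammar" where
  derives_root:
    "(v, f, vs) \<in> productions G \<Longrightarrow> derives G (Var v) (Fun f (map Var vs))"
| derives_inner:
    "derives G t t' \<Longrightarrow> derives G (Fun f (ls @ t # rs)) (Fun f (ls @ t' # rs))"

definition grammar_language :: "'a grammar \<Rightarrow> 'a forest" where
  "grammar_language G =
     {t \<in> ground_terms (symbols G) (symbol_rank G). (derives G)\<^sup>*\<^sup>* (Var (start G)) t}"

definition DRF :: "'a forest set" where
  "DRF = {grammar_language G | G. regular_tree_grammar G \<and> deterministic G}"

end

theory Submission
  imports Defs
begin

text \<open>
  Let \<open>K\<close> be the finite closure of \<open>t\<^sub>0\<close>.  The constraints on a type \<open>t\<close> that arise when \<open>t\<^sub>0 <: t\<close>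
  is decomposed all have the form \<open>t <: s\<close>, \<open>t = s\<close> or \<open>s <: t\<close> with \<open>s \<in> K\<close>: on the side of the
  ground type \<open>s\<close>, only decomposition and inheritance are ever applied.  Because a type inherits from at
  most one instance of each class, such a constraint on \<open>g(u\<^sub>1, \<dots>, u\<^sub>n)\<close> is either unsatisfiable or
  equivalent to a conjunction of constraints on the single \<open>u\<^sub>j\<close>.  Hence the sets of constraints are the
  variables of a deterministic grammar.  Conversely, a deterministic grammar is turned into a class table
  by making each symbol a covariant class without supertypes and each variable a class of rank 0 that
  inherits from the right-hand sides of its productions.
\<close>

section \<open>Terms and substitutions\<close>

lemma terms_Fun_iff:
  "Fun f ts \<in> terms A rk V \<longleftrightarrow> f \<in> A \<and> length ts = rk f \<and> (\<forall>t \<in> set ts. t \<in> terms A rk V)"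
  by (auto intro: terms_Fun elim: terms.cases)

lemma terms_Var_iff: "Var x \<in> terms A rk V \<longleftrightarrow> x \<in> V"
  by (auto intro: terms_Var elim: terms.cases)

lemma terms_mono:
  assumes "t \<in> terms A rk V" "A \<subseteq> B" "\<And>f. f \<in> A \<Longrightarrow> rk f = rk' f"
  shows "t \<in> terms B rk' V"
  using assms(1) by induction (use assms(2,3) in \<open>auto intro!: terms.intros\<close>)

lemma subst_in_terms:
  assumes "\<tau> \<in> terms A rk V" "\<And>x. x \<in> V \<Longrightarrow> \<sigma> x \<in> terms A rk W"
  shows "subst \<sigma> \<tau> \<in> terms A rk W"
  using assms(1) by induction (use assms(2) in \<open>auto simp: terms_Fun_iff\<close>)

lemma subst_cong:
  assumes "\<tau> \<in> terms A rk V" "\<And>x. x \<in> V \<Longrightarrow> \<sigma> x = \<sigma>' x"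
  shows "subst \<sigma> \<tau> = subst \<sigma>' \<tau>"
  using assms(1) by induction (use assms(2) in auto)

lemma subst_subst: "subst \<sigma> (subst \<rho> \<tau>) = subst (\<lambda>x. subst \<sigma> (\<rho> x)) \<tau>"
  by (induction \<tau>) auto

text \<open>The index is the first position of \<open>x\<close> in \<open>xs\<close>, so it is the
  same for all argument lists. \<open>subst_assign\<close> relies on this to read two argument lists
  at one common position.\<close>

lemma assign_eq_nth:
  assumes "x \<in> set xs"
  shows "\<exists>i < length xs. \<forall>us :: 'a trm list. length us = length xs \<longrightarrow> assign xs us x = us ! i"
  using assms
proof (induction xs)
  case (Cons y ys)
  show ?case
  proof (cases "x = y")
    case True
    then show ?thesis by (intro exI[of _ 0]) (auto simp: assign_def length_Suc_conv)
  next
    case False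
    then have "x \<in> set ys" using Cons(2) by simp
    from Cons(1)[OF this] obtain i
      where "i < length ys" "\<forall>us :: 'a trm list. length us = length ys \<longrightarrow> assign ys us x = us ! i"
      by blast
    with False show ?thesis
      by (intro exI[of _ "Suc i"]) (auto simp: assign_def length_Suc_conv)
  qed
qed simp

lemma assign_in_terms:
  fixes ts :: "'a trm list"
  assumes "x \<in> set xs" "length ts = length xs" "\<forall>t \<in> set ts. t \<in> terms A rk V"
  shows "assign xs ts x \<in> terms A rk V"
proof -
  obtain i where "i < length xs"
    "\<forall>us :: 'a trm list. length us = length xs \<longrightarrow> assign xs us x = us ! i"
    using assign_eq_nth[OF assms(1)] by blast
  then show ?thesis using assms(2,3) by simp
qed

text \<open>A variable outside \<open>xs\<close> is fixed by \<open>assign\<close>, and \<sigma>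
  would then act on it on the left side only; hence the restriction on the variables of
  \<tau>.\<close>

lemma subst_assign:
  fixes ts :: "'a trm list"
  assumes "\<tau> \<in> terms A rk (set xs)" "length ts = length xs"
  shows "subst \<sigma> (subst (assign xs ts) \<tau>) = subst (assign xs (map (subst \<sigma>) ts)) \<tau>"
  unfolding subst_subst
proof (rule subst_cong[OF assms(1)])
  fix x assume "x \<in> set xs"
  then obtain i where "i < length xs"
    "\<forall>us :: 'a trm list. length us = length xs \<longrightarrow> assign xs us x = us ! i"
    using assign_eq_nth by blast
  then show "subst \<sigma> (assign xs ts x) = assign xs (map (subst \<sigma>) ts) x"
    using assms(2) by simp
qed

lemma map_assign:
  assumes "distinct xs" "length ts = length xs"
  shows "map (assign xs ts) xs = ts"
proof (rule nth_equalityI)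
  fix i assume "i < length (map (assign xs ts) xs)"
  then have i: "i < length xs" by simp
  then have "map_of (zip xs ts) (xs ! i) = Some (ts ! i)"
    using assms by (subst map_of_zip_nth) auto
  then show "map (assign xs ts) xs ! i = ts ! i" using i by (simp add: assign_def)
qed (use assms in simp)

section \<open>Inheritance and subtyping\<close>

lemma length_param_names [simp]: "length (param_names \<Delta> g) = rank \<Delta> g"
  by (simp add: param_names_def rank_def)

lemma ground_types_Fun_iff:
  "Fun g ts \<in> ground_types \<Delta> \<longleftrightarrow>
     g \<in> classes \<Delta> \<and> length ts = rank \<Delta> g \<and> (\<forall>t \<in> set ts. t \<in> ground_types \<Delta>)"
  by (simp add: ground_types_def terms_Fun_iff)

lemma ground_types_not_Var: "Var x \<notin> ground_types \<Delta>"
  by (simp add: ground_types_def terms_Var_iff)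

section \<open>Constraints on ground types and their conjunctions\<close>

definition related :: "'a class_table \<Rightarrow> variance \<Rightarrow> 'a trm \<Rightarrow> 'a trm \<Rightarrow> bool" where
  "related \<Delta> v t s = (case v of Invariant \<Rightarrow> t = s
     | Covariant \<Rightarrow> subtype \<Delta> t s | Contravariant \<Rightarrow> subtype \<Delta> s t)"

lemma related_opposite: "related \<Delta> (opposite v) t s \<longleftrightarrow> related \<Delta> v s t"
  by (cases v) (auto simp: related_def)

definition satisfies :: "'a class_table \<Rightarrow> 'a trm \<Rightarrow> (variance \<times> 'a trm) set \<Rightarrow> bool" where
  "satisfies \<Delta> t Q \<longleftrightarrow> (\<forall>(v, s) \<in> Q. related \<Delta> v t s)"

text \<open>The solutions of \<open>P\<close> among ground assignments form a product, with one set
  of constraints for each variable in \<open>V\<close> and all bounds in \<open>K\<close>. Such a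
  condition splits into independent conditions on the arguments, which is what a single grammar
  production can express.\<close>

definition boxed :: "'a class_table \<Rightarrow> 'a trm set \<Rightarrow> nat set \<Rightarrow> ((nat \<Rightarrow> 'a trm) \<Rightarrow> bool) \<Rightarrow> bool" where
  "boxed \<Delta> K V P \<longleftrightarrow> (\<exists>Q. (\<forall>x. Q x \<subseteq> UNIV \<times> K) \<and>
     (\<forall>\<sigma>. (\<forall>x \<in> V. \<sigma> x \<in> ground_types \<Delta>) \<longrightarrow> (P \<sigma> \<longleftrightarrow> (\<forall>x \<in> V. satisfies \<Delta> (\<sigma> x) (Q x)))))"

lemma subtype_Fun:
  assumes "Fun g ts \<in> ground_types \<Delta>" "Fun g ts' \<in> ground_types \<Delta>"
    "\<And>i. i < rank \<Delta> g \<Longrightarrow> related \<Delta> (var \<Delta> g i) (ts ! i) (ts' ! i)"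
  shows "subtype \<Delta> (Fun g ts) (Fun g ts')"
proof (rule subtype_Var[OF assms(1,2)], intro allI impI)
  fix i assume "i < rank \<Delta> g"
  from assms(3)[OF this] show "(var \<Delta> g i = Covariant \<longrightarrow> subtype \<Delta> (ts ! i) (ts' ! i)) \<and>
      (var \<Delta> g i = Invariant \<longrightarrow> ts ! i = ts' ! i) \<and>
      (var \<Delta> g i = Contravariant \<longrightarrow> subtype \<Delta> (ts' ! i) (ts ! i))"
    by (auto simp: related_def)
qed

lemma subtype_Supers:
  "(inherits \<Delta>)\<^sup>*\<^sup>* t t' \<Longrightarrow> subtype \<Delta> t' t'' \<Longrightarrow> subtype \<Delta> t t''"
  by (induction rule: converse_rtranclp_induct) (auto intro: subtype_Super)

text \<open>A derivation is a chain of inheritance steps closed by one comparison of arguments.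
  Treating the whole chain as one step leaves induction hypotheses for the arguments only.\<close>

lemma subtype_strong_induct [consumes 1, case_names step]:
  assumes "subtype \<Delta> a b"
    and step: "\<And>t g ts ts'. (inherits \<Delta>)\<^sup>*\<^sup>* t (Fun g ts) \<Longrightarrow> Fun g ts \<in> ground_types \<Delta> \<Longrightarrow>
      Fun g ts' \<in> ground_types \<Delta> \<Longrightarrow>
      (\<And>i. i < rank \<Delta> g \<Longrightarrow> related \<Delta> (var \<Delta> g i) (ts ! i) (ts' ! i)) \<Longrightarrow>
      (\<And>i. i < rank \<Delta> g \<Longrightarrow> var \<Delta> g i = Covariant \<Longrightarrow> P (ts ! i) (ts' ! i)) \<Longrightarrow>
      (\<And>i. i < rank \<Delta> g \<Longrightarrow> var \<Delta> g i = Contravariant \<Longrightarrow> P (ts' ! i) (ts ! i)) \<Longrightarrow>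
      P t (Fun g ts')"
  shows "P a b"
proof -
  \<comment> \<open>\<open>Q\<close> collects the premises of \<open>step\<close>. Unlike
    \<open>P\<close>, it passes through an inheritance step, which merely lengthens the chain from
    \<open>a\<close>.\<close>
  define Q where "Q a b \<longleftrightarrow> (\<exists>g ts ts'. b = Fun g ts' \<and> (inherits \<Delta>)\<^sup>*\<^sup>* a (Fun g ts) \<and>
      Fun g ts \<in> ground_types \<Delta> \<and> Fun g ts' \<in> ground_types \<Delta> \<and>
      (\<forall>i < rank \<Delta> g. related \<Delta> (var \<Delta> g i) (ts ! i) (ts' ! i) \<and>
        (var \<Delta> g i = Covariant \<longrightarrow> P (ts ! i) (ts' ! i)) \<and>
        (var \<Delta> g i = Contravariant \<longrightarrow> P (ts' ! i) (ts ! i))))" for a b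
  have *: "P a b" if ab: "Q a b" for a b
  proof -
    from ab obtain g ts ts' where b: "b = Fun g ts'"
      and "(inherits \<Delta>)\<^sup>*\<^sup>* a (Fun g ts)" "Fun g ts \<in> ground_types \<Delta>" "Fun g ts' \<in> ground_types \<Delta>"
      and i: "\<forall>i < rank \<Delta> g. related \<Delta> (var \<Delta> g i) (ts ! i) (ts' ! i) \<and>
        (var \<Delta> g i = Covariant \<longrightarrow> P (ts ! i) (ts' ! i)) \<and>
        (var \<Delta> g i = Contravariant \<longrightarrow> P (ts' ! i) (ts ! i))"
      unfolding Q_def by blast
    then show ?thesis unfolding b by (intro step[of a g ts ts']) (use i in blast)+
  qed
  have Q: "Q a b"
    if "subtype \<Delta> a b" for a b
    using that
  proof induction
    case (subtype_Var g ts ts')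
    have "related \<Delta> (var \<Delta> g i) (ts ! i) (ts' ! i) \<and>
        (var \<Delta> g i = Covariant \<longrightarrow> P (ts ! i) (ts' ! i)) \<and>
        (var \<Delta> g i = Contravariant \<longrightarrow> P (ts' ! i) (ts ! i))" if "i < rank \<Delta> g" for i
      using subtype_Var(3)[rule_format, OF that] *
      by (cases "var \<Delta> g i") (simp_all add: related_def)
    then show ?case using subtype_Var(1,2) unfolding Q_def by blast
  next
    case (subtype_Super t t' t'')
    have "(inherits \<Delta>)\<^sup>*\<^sup>* t s" if "(inherits \<Delta>)\<^sup>*\<^sup>* t' s" for s
      using subtype_Super(1) that by (rule converse_rtranclp_into_rtranclp)
    then show ?case using subtype_Super(3) unfolding Q_def by blast
  qed
  from Q[OF assms(1)] show ?thesis by (rule *)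
qed

lemma subtypeE:
  assumes "subtype \<Delta> a b"
  obtains g ts ts' where "b = Fun g ts'" "(inherits \<Delta>)\<^sup>*\<^sup>* a (Fun g ts)" "Fun g ts \<in> ground_types \<Delta>"
    "Fun g ts' \<in> ground_types \<Delta>"
    "\<And>i. i < rank \<Delta> g \<Longrightarrow> related \<Delta> (var \<Delta> g i) (ts ! i) (ts' ! i)"
proof -
  have "\<exists>g ts ts'. b = Fun g ts' \<and> (inherits \<Delta>)\<^sup>*\<^sup>* a (Fun g ts) \<and> Fun g ts \<in> ground_types \<Delta> \<and>
      Fun g ts' \<in> ground_types \<Delta> \<and>
      (\<forall>i < rank \<Delta> g. related \<Delta> (var \<Delta> g i) (ts ! i) (ts' ! i))"
    using assms by (rule subtype_strong_induct) blast
  then show ?thesis using that by blast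
qed

section \<open>Inheritance on types with parameters, on ground types and on classes\<close>

context
  fixes \<Delta> :: "'a class_table"
  assumes ct: "class_table \<Delta>"
begin

lemma supers_in_terms:
  assumes "g \<in> classes \<Delta>" "\<tau> \<in> set (supers \<Delta> g)"
  shows "\<tau> \<in> terms (classes \<Delta>) (rank \<Delta>) (set (param_names \<Delta> g))"
  using assms ct by (auto simp: class_table_def)

lemma supersE:
  assumes "g \<in> classes \<Delta>" "\<tau> \<in> set (supers \<Delta> g)"
  obtains g' \<tau>s where "\<tau> = Fun g' \<tau>s"
  using assms ct by (cases \<tau>) (auto simp: class_table_def)

text \<open>The type has a class at its root before the substitution, so the step depends on that
  class alone and happens under every ground substitution. The result again has a class at its root,
  as no declared supertype is a parameter; the lifting can thus be iterated along a chain.\<close>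

lemma inherits_lift:
  assumes "inherits \<Delta> (subst \<sigma>\<^sub>0 (Fun g \<tau>s)) t'" "Fun g \<tau>s \<in> terms (classes \<Delta>) (rank \<Delta>) V"
  obtains g' \<rho>s where "Fun g' \<rho>s \<in> terms (classes \<Delta>) (rank \<Delta>) V" "t' = subst \<sigma>\<^sub>0 (Fun g' \<rho>s)"
    "\<And>\<sigma>. (\<And>x. x \<in> V \<Longrightarrow> \<sigma> x \<in> ground_types \<Delta>) \<Longrightarrow>
      inherits \<Delta> (subst \<sigma> (Fun g \<tau>s)) (subst \<sigma> (Fun g' \<rho>s))"
proof -
  have g: "g \<in> classes \<Delta>" and len: "length \<tau>s = length (param_names \<Delta> g)"
    and \<tau>s: "\<forall>t \<in> set \<tau>s. t \<in> terms (classes \<Delta>) (rank \<Delta>) V"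
    using assms(2) by (auto simp: terms_Fun_iff)
  from assms(1) obtain \<kappa> where \<kappa>: "\<kappa> \<in> set (supers \<Delta> g)"
    and t': "t' = subst (assign (param_names \<Delta> g) (map (subst \<sigma>\<^sub>0) \<tau>s)) \<kappa>"
    by (auto elim: inherits.cases)
  define \<rho> where "\<rho> = subst (assign (param_names \<Delta> g) \<tau>s) \<kappa>"
  have \<kappa>_terms: "\<kappa> \<in> terms (classes \<Delta>) (rank \<Delta>) (set (param_names \<Delta> g))"
    using supers_in_terms[OF g \<kappa>] .
  have eq: "subst \<sigma> \<rho> = subst (assign (param_names \<Delta> g) (map (subst \<sigma>) \<tau>s)) \<kappa>" for \<sigma>
    unfolding \<rho>_def by (rule subst_assign[OF \<kappa>_terms len])
  have \<rho>: "\<rho> \<in> terms (classes \<Delta>) (rank \<Delta>) V"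
    unfolding \<rho>_def using \<tau>s len by (intro subst_in_terms[OF \<kappa>_terms] assign_in_terms)
  have "inherits \<Delta> (subst \<sigma> (Fun g \<tau>s)) (subst \<sigma> \<rho>)"
    if "\<And>x. x \<in> V \<Longrightarrow> \<sigma> x \<in> ground_types \<Delta>" for \<sigma>
    using subst_in_terms[OF assms(2), of \<sigma> "{}"] that \<kappa> inherits.intros[of g "map (subst \<sigma>) \<tau>s" \<Delta> \<kappa>]
    unfolding eq by (auto simp: ground_types_def)
  moreover obtain g' \<kappa>s where "\<kappa> = Fun g' \<kappa>s"
    using supersE[OF g \<kappa>] .
  then obtain \<rho>s where "\<rho> = Fun g' \<rho>s" by (simp add: \<rho>_def)
  ultimately show ?thesis using that[of g' \<rho>s] \<rho> t' eq[of \<sigma>\<^sub>0] by simp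
qed

lemma inherits_star_lift:
  assumes "(inherits \<Delta>)\<^sup>*\<^sup>* (subst \<sigma>\<^sub>0 (Fun g \<tau>s)) t'"
    "Fun g \<tau>s \<in> terms (classes \<Delta>) (rank \<Delta>) V"
  obtains g' \<rho>s where "Fun g' \<rho>s \<in> terms (classes \<Delta>) (rank \<Delta>) V" "t' = subst \<sigma>\<^sub>0 (Fun g' \<rho>s)"
    "\<And>\<sigma>. (\<And>x. x \<in> V \<Longrightarrow> \<sigma> x \<in> ground_types \<Delta>) \<Longrightarrow>
      (inherits \<Delta>)\<^sup>*\<^sup>* (subst \<sigma> (Fun g \<tau>s)) (subst \<sigma> (Fun g' \<rho>s))"
proof -
  have "\<exists>g' \<rho>s. Fun g' \<rho>s \<in> terms (classes \<Delta>) (rank \<Delta>) V \<and> t' = subst \<sigma>\<^sub>0 (Fun g' \<rho>s) \<and>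
    (\<forall>\<sigma>. (\<forall>x \<in> V. \<sigma> x \<in> ground_types \<Delta>) \<longrightarrow>
      (inherits \<Delta>)\<^sup>*\<^sup>* (subst \<sigma> (Fun g \<tau>s)) (subst \<sigma> (Fun g' \<rho>s)))"
    using assms(1)
  proof (induction rule: rtranclp_induct)
    case base
    then show ?case using assms(2) by blast
  next
    case (step t' t'')
    then obtain g' \<rho>s where 1: "Fun g' \<rho>s \<in> terms (classes \<Delta>) (rank \<Delta>) V"
      "t' = subst \<sigma>\<^sub>0 (Fun g' \<rho>s)"
      and 2: "\<forall>\<sigma>. (\<forall>x \<in> V. \<sigma> x \<in> ground_types \<Delta>) \<longrightarrow>
        (inherits \<Delta>)\<^sup>*\<^sup>* (subst \<sigma> (Fun g \<tau>s)) (subst \<sigma> (Fun g' \<rho>s))"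
      by blast
    from inherits_lift[OF step(2)[unfolded 1(2)] 1(1)] obtain g'' \<rho>s' where 3:
      "Fun g'' \<rho>s' \<in> terms (classes \<Delta>) (rank \<Delta>) V" "t'' = subst \<sigma>\<^sub>0 (Fun g'' \<rho>s')"
      "\<forall>\<sigma>. (\<forall>x \<in> V. \<sigma> x \<in> ground_types \<Delta>) \<longrightarrow>
        inherits \<Delta> (subst \<sigma> (Fun g' \<rho>s)) (subst \<sigma> (Fun g'' \<rho>s'))"
      by metis
    have "(inherits \<Delta>)\<^sup>*\<^sup>* (subst \<sigma> (Fun g \<tau>s)) (subst \<sigma> (Fun g'' \<rho>s'))"
      if "\<forall>x \<in> V. \<sigma> x \<in> ground_types \<Delta>" for \<sigma>
      using 2[rule_format, of \<sigma>] 3(3)[rule_format, of \<sigma>] that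
      by (blast intro: rtranclp.rtrancl_into_rtrancl)
    then show ?case using 3(1,2) by blast
  qed
  then show ?thesis using that by blast
qed

lemma class_inherits_in_terms:
  "class_inherits \<Delta> g \<tau> \<Longrightarrow>
    g \<in> classes \<Delta> \<and> \<tau> \<in> terms (classes \<Delta>) (rank \<Delta>) (set (param_names \<Delta> g))"
proof (induction rule: class_inherits.induct)
  case (class_inherits_refl g)
  then show ?case by (auto simp: terms_Fun_iff terms_Var_iff)
next
  case (class_inherits_step g g' \<tau>s \<tau>)
  have "Fun g' \<tau>s \<in> terms (classes \<Delta>) (rank \<Delta>) (set (param_names \<Delta> g))"
    using supers_in_terms class_inherits_step by blast
  then show ?case using class_inherits_step
    by (auto simp: terms_Fun_iff intro!: subst_in_terms assign_in_terms)
qed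

lemma inherits_ground:
  assumes "inherits \<Delta> t t'"
  shows "t \<in> ground_types \<Delta>" "t' \<in> ground_types \<Delta>"
proof -
  from assms obtain g ts \<tau> where *: "t = Fun g ts" "t' = subst (assign (param_names \<Delta> g) ts) \<tau>"
    "t \<in> ground_types \<Delta>" "\<tau> \<in> set (supers \<Delta> g)"
    by (auto elim: inherits.cases)
  then show "t \<in> ground_types \<Delta>" by simp
  show "t' \<in> ground_types \<Delta>" unfolding * ground_types_def
    using * by (intro subst_in_terms[OF supers_in_terms[of g]] assign_in_terms)
      (auto simp: ground_types_def terms_Fun_iff)
qed

text \<open>The chain is peeled at its first step, because \<open>class_inherits_step\<close> adds a
  declared supertype in front; \<open>subst_assign\<close> then composes the two instantiations.
  This carries conditions on classes over to ground types.\<close>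

lemma class_inherits_of_inherits:
  assumes "(inherits \<Delta>)\<^sup>*\<^sup>* (Fun g ts) t'" "Fun g ts \<in> ground_types \<Delta>"
  shows "\<exists>\<tau>. class_inherits \<Delta> g \<tau> \<and> t' = subst (assign (param_names \<Delta> g) ts) \<tau>"
  using assms
proof (induction "Fun g ts" arbitrary: g ts rule: converse_rtranclp_induct)
  case base
  have "map (assign (param_names \<Delta> g) ts) (param_names \<Delta> g) = ts"
    using base ct by (intro map_assign) (auto simp: class_table_def ground_types_Fun_iff)
  then show ?case using base
    by (intro exI[of _ "Fun g (map Var (param_names \<Delta> g))"])
      (auto simp: ground_types_Fun_iff comp_def intro: class_inherits_refl)
next
  case (step z)
  from step(1) obtain \<kappa> where \<kappa>: "\<kappa> \<in> set (supers \<Delta> g)"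
    "z = subst (assign (param_names \<Delta> g) ts) \<kappa>"
    by (auto elim: inherits.cases)
  have g: "g \<in> classes \<Delta>" using step(4) by (simp add: ground_types_Fun_iff)
  obtain g' \<tau>s where \<kappa>': "\<kappa> = Fun g' \<tau>s" using supersE[OF g \<kappa>(1)] .
  have z: "z = Fun g' (map (subst (assign (param_names \<Delta> g) ts)) \<tau>s)" using \<kappa> \<kappa>' by simp
  from step(3)[OF z] inherits_ground(2)[OF step(1)] z obtain \<tau> where
    \<tau>: "class_inherits \<Delta> g' \<tau>"
    "t' = subst (assign (param_names \<Delta> g') (map (subst (assign (param_names \<Delta> g) ts)) \<tau>s)) \<tau>"
    by auto
  have "length \<tau>s = length (param_names \<Delta> g')"
    using supers_in_terms[OF g \<kappa>(1)] \<kappa>' by (auto simp: terms_Fun_iff)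
  then have "t' = subst (assign (param_names \<Delta> g) ts) (subst (assign (param_names \<Delta> g') \<tau>s) \<tau>)"
    using class_inherits_in_terms[OF \<tau>(1)] \<tau>(2) by (subst subst_assign) auto
  then show ?case using class_inherits_step[OF g _ \<tau>(1)] \<kappa>(1) \<kappa>' by auto
qed

lemma class_inherits_plus_of_inherits:
  assumes "(inherits \<Delta>)\<^sup>+\<^sup>+ (Fun g ts) t'" "Fun g ts \<in> ground_types \<Delta>"
  shows "\<exists>\<tau>. class_inherits_plus \<Delta> g \<tau> \<and> t' = subst (assign (param_names \<Delta> g) ts) \<tau>"
proof -
  from assms(1) obtain z where z1: "inherits \<Delta> (Fun g ts) z" and z2: "(inherits \<Delta>)\<^sup>*\<^sup>* z t'"
    by (metis tranclpD)
  from z1 obtain \<kappa> where \<kappa>: "\<kappa> \<in> set (supers \<Delta> g)"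
    "z = subst (assign (param_names \<Delta> g) ts) \<kappa>"
    by (auto elim: inherits.cases)
  have g: "g \<in> classes \<Delta>" using assms(2) by (simp add: ground_types_Fun_iff)
  obtain g' \<tau>s where \<kappa>': "\<kappa> = Fun g' \<tau>s" using supersE[OF g \<kappa>(1)] .
  have z: "z = Fun g' (map (subst (assign (param_names \<Delta> g) ts)) \<tau>s)" using \<kappa> \<kappa>' by simp
  from class_inherits_of_inherits z2 inherits_ground(2)[OF z1] z obtain \<tau> where
    \<tau>: "class_inherits \<Delta> g' \<tau>"
    "t' = subst (assign (param_names \<Delta> g') (map (subst (assign (param_names \<Delta> g) ts)) \<tau>s)) \<tau>"
    by metis
  have "length \<tau>s = length (param_names \<Delta> g')"
    using supers_in_terms[OF g \<kappa>(1)] \<kappa>' by (auto simp: terms_Fun_iff)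
  then have "t' = subst (assign (param_names \<Delta> g) ts) (subst (assign (param_names \<Delta> g') \<tau>s) \<tau>)"
    using class_inherits_in_terms[OF \<tau>(1)] \<tau>(2) by (subst subst_assign) auto
  then show ?thesis using class_inherits_plus.intros[OF g _ \<tau>(1)] \<kappa>(1) \<kappa>' by auto
qed

text \<open>Excludes that the root class of an inherited ground type comes from an argument, so that
  \<open>single_instantiation\<close>, which speaks of terms with a class at the root, can be
  applied.\<close>

lemma class_inherits_plus_not_Var: "\<not> class_inherits_plus \<Delta> g (Var x)"
proof -
  have ci: "\<exists>h \<rho>s. \<tau> = Fun h \<rho>s" if "class_inherits \<Delta> g' \<tau>" for g' \<tau>
    using that by (induction rule: class_inherits.induct) auto
  show ?thesis by (auto elim!: class_inherits_plus.cases dest!: ci)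
qed

context
  assumes acyc: "acyclic_inheritance \<Delta>" and single: "single_instantiation \<Delta>"
begin

text \<open>If \<open>t\<close> is itself an instance of \<open>g\<close>, acyclicity makes both
  chains empty. Otherwise both have at least one step, and single instantiation identifies the
  class-level supertypes of which the two types are instances.\<close>

lemma inherits_unique:
  assumes "(inherits \<Delta>)\<^sup>*\<^sup>* t (Fun g as)" "(inherits \<Delta>)\<^sup>*\<^sup>* t (Fun g bs)" "t \<in> ground_types \<Delta>"
  shows "as = bs"
proof (cases t)
  case (Var x)
  then show ?thesis using assms(3) ground_types_not_Var by metis
next
  case (Fun h ts)
  show ?thesis
  proof (cases "h = g")
    case True
    have "\<not> (inherits \<Delta>)\<^sup>+\<^sup>+ t (Fun g cs)" for cs
      using acyc Fun True unfolding acyclic_inheritance_def by blast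
    then have "t = Fun g as" "t = Fun g bs"
      using rtranclpD[OF assms(1)] rtranclpD[OF assms(2)] by blast+
    then show ?thesis by simp
  next
    case False
    then have "(inherits \<Delta>)\<^sup>+\<^sup>+ (Fun h ts) (Fun g as)" "(inherits \<Delta>)\<^sup>+\<^sup>+ (Fun h ts) (Fun g bs)"
      using rtranclpD[OF assms(1)] rtranclpD[OF assms(2)] Fun by auto
    from class_inherits_plus_of_inherits[OF this(1)] class_inherits_plus_of_inherits[OF this(2)]
    obtain \<tau> \<tau>' where \<tau>: "class_inherits_plus \<Delta> h \<tau>" "class_inherits_plus \<Delta> h \<tau>'"
      "Fun g as = subst (assign (param_names \<Delta> h) ts) \<tau>"
      "Fun g bs = subst (assign (param_names \<Delta> h) ts) \<tau>'"
      using assms(3) Fun by blast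
    obtain \<tau>s where "\<tau> = Fun g \<tau>s"
      using \<tau>(1,3) class_inherits_plus_not_Var by (cases \<tau>) auto
    moreover obtain \<tau>s' where "\<tau>' = Fun g \<tau>s'"
      using \<tau>(2,4) class_inherits_plus_not_Var by (cases \<tau>') auto
    ultimately have "\<tau> = \<tau>'" using \<tau>(1,2) single unfolding single_instantiation_def by blast
    then show ?thesis using \<tau>(3,4) by (metis trm.inject(2))
  qed
qed

text \<open>By uniqueness the closing comparison of any derivation must start from
  \<open>Fun g ts\<close>. Deciding a subtyping therefore involves no choice and becomes a
  conjunction over the arguments.\<close>

lemma subtype_iff_related:
  assumes "(inherits \<Delta>)\<^sup>*\<^sup>* t (Fun g ts)" "t \<in> ground_types \<Delta>" "Fun g ts \<in> ground_types \<Delta>"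
    "Fun g ts' \<in> ground_types \<Delta>"
  shows "subtype \<Delta> t (Fun g ts') \<longleftrightarrow>
    (\<forall>i < rank \<Delta> g. related \<Delta> (var \<Delta> g i) (ts ! i) (ts' ! i))"
proof
  assume "subtype \<Delta> t (Fun g ts')"
  then obtain us where "(inherits \<Delta>)\<^sup>*\<^sup>* t (Fun g us)"
    "\<forall>i < rank \<Delta> g. related \<Delta> (var \<Delta> g i) (us ! i) (ts' ! i)"
    by (rule subtypeE) auto
  then show "\<forall>i < rank \<Delta> g. related \<Delta> (var \<Delta> g i) (ts ! i) (ts' ! i)"
    using inherits_unique[OF assms(1) _ assms(2)] by blast
next
  assume "\<forall>i < rank \<Delta> g. related \<Delta> (var \<Delta> g i) (ts ! i) (ts' ! i)"
  then show "subtype \<Delta> t (Fun g ts')"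
    using assms by (intro subtype_Supers[OF assms(1)] subtype_Fun) auto
qed

section \<open>Constraints on the parameters\<close>

lemma boxed_cong:
  assumes "boxed \<Delta> K V P" "\<And>\<sigma>. (\<And>x. x \<in> V \<Longrightarrow> \<sigma> x \<in> ground_types \<Delta>) \<Longrightarrow> P' \<sigma> \<longleftrightarrow> P \<sigma>"
  shows "boxed \<Delta> K V P'"
  using assms unfolding boxed_def by metis

text \<open>Conjunction of predicates corresponds to the union of constraint sets, taken separately
  at each variable.\<close>

lemma boxed_Ball:
  assumes "\<And>i. i \<in> I \<Longrightarrow> boxed \<Delta> K V (P i)"
  shows "boxed \<Delta> K V (\<lambda>\<sigma>. \<forall>i \<in> I. P i \<sigma>)"
proof -
  from assms obtain Q where Q: "\<And>i. i \<in> I \<Longrightarrow> (\<forall>x. Q i x \<subseteq> UNIV \<times> K) \<and>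
     (\<forall>\<sigma>. (\<forall>x \<in> V. \<sigma> x \<in> ground_types \<Delta>) \<longrightarrow> (P i \<sigma> \<longleftrightarrow> (\<forall>x \<in> V. satisfies \<Delta> (\<sigma> x) (Q i x))))"
    unfolding boxed_def by metis
  have "satisfies \<Delta> t (\<Union>i \<in> I. Q i x) \<longleftrightarrow> (\<forall>i \<in> I. satisfies \<Delta> t (Q i x))" for t x
    by (auto simp: satisfies_def)
  with Q show ?thesis unfolding boxed_def
    by (intro exI[of _ "\<lambda>x. \<Union>i \<in> I. Q i x"]) (auto simp del: UN_simps; blast)
qed

lemma boxed_Var:
  assumes "x \<in> V" "s \<in> K"
  shows "boxed \<Delta> K V (\<lambda>\<sigma>. related \<Delta> v (\<sigma> x) s)"
  unfolding boxed_def
  by (intro exI[of _ "\<lambda>y. if y = x then {(v, s)} else {}"]) (use assms in \<open>auto simp: satisfies_def\<close>)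

section \<open>Bounds in a set closed under decomposition and inheritance\<close>

context
  fixes K :: "'a trm set"
  assumes K_ground: "K \<subseteq> ground_types \<Delta>"
    and K_args: "\<And>g ts t. Fun g ts \<in> K \<Longrightarrow> t \<in> set ts \<Longrightarrow> t \<in> K"
    and K_inherits: "\<And>t t'. t \<in> K \<Longrightarrow> inherits \<Delta> t t' \<Longrightarrow> t' \<in> K"
begin

text \<open>Matching \<tau> against its own instance descends to the variables, and the subterms met
  on the way stay in \<open>K\<close>. The witness \<open>\<sigma>\<^sub>0\<close> matters: for
  empty \<open>V\<close> a product condition is true, so an unsatisfiable predicate is not boxed
  there.\<close>

lemma boxed_eq:
  assumes "\<tau> \<in> terms (classes \<Delta>) (rank \<Delta>) V" "subst \<sigma>\<^sub>0 \<tau> \<in> K"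
  shows "boxed \<Delta> K V (\<lambda>\<sigma>. subst \<sigma> \<tau> = subst \<sigma>\<^sub>0 \<tau>)"
  using assms
proof induction
  case (terms_Var x)
  then show ?case using boxed_Var[of x V "\<sigma>\<^sub>0 x" K Invariant] by (simp add: related_def)
next
  case (terms_Fun f ts)
  have "boxed \<Delta> K V (\<lambda>\<sigma>. \<forall>t \<in> set ts. subst \<sigma> t = subst \<sigma>\<^sub>0 t)"
    using terms_Fun K_args[OF terms_Fun(5)[unfolded subst.simps]] by (intro boxed_Ball) auto
  then show ?case by (rule boxed_cong) auto
qed

lemma K_inherits_star: "(inherits \<Delta>)\<^sup>*\<^sup>* t t' \<Longrightarrow> t \<in> K \<Longrightarrow> t' \<in> K"
  by (induction rule: rtranclp_induct) (auto intro: K_inherits)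

lemma ground_types_subst:
  assumes "\<tau> \<in> terms (classes \<Delta>) (rank \<Delta>) V" "\<And>x. x \<in> V \<Longrightarrow> \<sigma> x \<in> ground_types \<Delta>"
  shows "subst \<sigma> \<tau> \<in> ground_types \<Delta>"
  using subst_in_terms[OF assms(1), of \<sigma> "{}"] assms(2) by (simp add: ground_types_def)

text \<open>Induction on the derivation for the witness, since the instances of \<open>\<tau>\<close> grow under inheritance.\<close>

lemma boxed_subtype:
  assumes "subtype \<Delta> a b"
  shows "(\<forall>\<tau> \<sigma>\<^sub>0. \<tau> \<in> terms (classes \<Delta>) (rank \<Delta>) V \<longrightarrow> a = subst \<sigma>\<^sub>0 \<tau> \<longrightarrow> b \<in> K \<longrightarrow>
      boxed \<Delta> K V (\<lambda>\<sigma>. related \<Delta> Covariant (subst \<sigma> \<tau>) b)) \<and>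
    (\<forall>\<tau> \<sigma>\<^sub>0. \<tau> \<in> terms (classes \<Delta>) (rank \<Delta>) V \<longrightarrow> b = subst \<sigma>\<^sub>0 \<tau> \<longrightarrow> a \<in> K \<longrightarrow>
      boxed \<Delta> K V (\<lambda>\<sigma>. related \<Delta> Contravariant (subst \<sigma> \<tau>) a))"
  using assms
proof (induction rule: subtype_strong_induct)
  case (step t g ts ts')
  have len: "length ts = rank \<Delta> g" "length ts' = rank \<Delta> g"
    using step(2,3) by (auto simp: ground_types_Fun_iff)
  \<comment> \<open>The two halves of the claim are proved together because contravariant arguments
    exchange the sides and hence the halves.\<close>
  have sub: "boxed \<Delta> K V (\<lambda>\<sigma>. related \<Delta> Covariant (subst \<sigma> \<tau>) (Fun g ts'))"
    if \<tau>: "\<tau> \<in> terms (classes \<Delta>) (rank \<Delta>) V" "t = subst \<sigma>\<^sub>0 \<tau>" and b: "Fun g ts' \<in> K" for \<tau> \<sigma>\<^sub>0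
  proof (cases \<tau>)
    case (Var x)
    then show ?thesis using boxed_Var[of x V _ K] \<tau> b by (simp add: terms_Var_iff)
  next
    case (Fun h \<tau>s)
    \<comment> \<open>The chain found for the witness is lifted to \<tau>, so that every ground
      substitution reaches an instance of the same class \<open>g\<close>.\<close>
    have "(inherits \<Delta>)\<^sup>*\<^sup>* (subst \<sigma>\<^sub>0 (Fun h \<tau>s)) (Fun g ts)"
      "Fun h \<tau>s \<in> terms (classes \<Delta>) (rank \<Delta>) V"
      using step(1) \<tau> Fun by auto
    then obtain g' \<rho>s where \<rho>': "Fun g' \<rho>s \<in> terms (classes \<Delta>) (rank \<Delta>) V"
      "Fun g ts = subst \<sigma>\<^sub>0 (Fun g' \<rho>s)"
      "\<And>\<sigma>. (\<And>x. x \<in> V \<Longrightarrow> \<sigma> x \<in> ground_types \<Delta>) \<Longrightarrow>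
        (inherits \<Delta>)\<^sup>*\<^sup>* (subst \<sigma> (Fun h \<tau>s)) (subst \<sigma> (Fun g' \<rho>s))"
      by (rule inherits_star_lift) blast
    have \<rho>_eq: "g' = g" "ts = map (subst \<sigma>\<^sub>0) \<rho>s" using \<rho>'(2) by simp_all
    have \<rho>: "Fun g \<rho>s \<in> terms (classes \<Delta>) (rank \<Delta>) V"
      using \<rho>'(1) \<rho>_eq(1) by simp
    have \<rho>_star: "(inherits \<Delta>)\<^sup>*\<^sup>* (subst \<sigma> \<tau>) (subst \<sigma> (Fun g \<rho>s))"
      if "\<And>x. x \<in> V \<Longrightarrow> \<sigma> x \<in> ground_types \<Delta>" for \<sigma>
      using \<rho>'(3)[OF that] unfolding \<rho>_eq(1) Fun .
    have "boxed \<Delta> K V (\<lambda>\<sigma>. \<forall>i \<in> {..<rank \<Delta> g}. related \<Delta> (var \<Delta> g i) (subst \<sigma> (\<rho>s ! i)) (ts' ! i))"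
    proof (rule boxed_Ball)
      fix i assume "i \<in> {..<rank \<Delta> g}"
      then have i: "i < rank \<Delta> g" by simp
      have *: "\<rho>s ! i \<in> terms (classes \<Delta>) (rank \<Delta>) V" "ts ! i = subst \<sigma>\<^sub>0 (\<rho>s ! i)" "ts' ! i \<in> K"
        using \<rho> \<rho>_eq(2) i len K_args[OF b, of "ts' ! i"] by (simp_all add: terms_Fun_iff)
      show "boxed \<Delta> K V (\<lambda>\<sigma>. related \<Delta> (var \<Delta> g i) (subst \<sigma> (\<rho>s ! i)) (ts' ! i))"
      proof (cases "var \<Delta> g i")
        case Invariant
        then have "ts' ! i = subst \<sigma>\<^sub>0 (\<rho>s ! i)" using step(4)[OF i] * by (simp add: related_def)
        then show ?thesis using boxed_eq[OF *(1), of \<sigma>\<^sub>0] *(3) Invariant by (simp add: related_def)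
      next
        case Covariant
        show ?thesis
          using step(5)[OF i Covariant, THEN conjunct1, rule_format, OF *] Covariant by simp
      next
        case Contravariant
        show ?thesis
          using step(6)[OF i Contravariant, THEN conjunct2, rule_format, OF *] Contravariant by simp
      qed
    qed
    then show ?thesis
    proof (rule boxed_cong)
      fix \<sigma> assume \<sigma>: "\<And>x. x \<in> V \<Longrightarrow> \<sigma> x \<in> ground_types \<Delta>"
      have len': "length \<rho>s = rank \<Delta> g" using \<rho> by (simp add: terms_Fun_iff)
      have "(inherits \<Delta>)\<^sup>*\<^sup>* (subst \<sigma> \<tau>) (Fun g (map (subst \<sigma>) \<rho>s))"
        "Fun g (map (subst \<sigma>) \<rho>s) \<in> ground_types \<Delta>"
        using \<rho>_star[OF \<sigma>] ground_types_subst[OF \<rho> \<sigma>] by simp_all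
      from subtype_iff_related[OF this(1) ground_types_subst[OF \<tau>(1) \<sigma>] this(2) step(3)]
      show "related \<Delta> Covariant (subst \<sigma> \<tau>) (Fun g ts') \<longleftrightarrow>
        (\<forall>i \<in> {..<rank \<Delta> g}. related \<Delta> (var \<Delta> g i) (subst \<sigma> (\<rho>s ! i)) (ts' ! i))"
        using len' by (simp add: related_def[of _ Covariant] Ball_def)
    qed
  qed
  have super: "boxed \<Delta> K V (\<lambda>\<sigma>. related \<Delta> Contravariant (subst \<sigma> \<tau>) t)"
    if \<tau>: "\<tau> \<in> terms (classes \<Delta>) (rank \<Delta>) V" "Fun g ts' = subst \<sigma>\<^sub>0 \<tau>" and a: "t \<in> K" for \<tau> \<sigma>\<^sub>0
  proof (cases \<tau>)
    case (Var x)
    then show ?thesis using boxed_Var[of x V _ K] \<tau> a by (simp add: terms_Var_iff)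
  next
    case (Fun h \<rho>s)
    have \<rho>: "\<tau> = Fun g \<rho>s" "ts' = map (subst \<sigma>\<^sub>0) \<rho>s" using Fun \<tau>(2) by auto
    \<comment> \<open>Here the chain runs on the side of the fixed bound and stays in
      \<open>K\<close>, while \<tau> is only decomposed. Since \<tau> now stands on the right, the
      variances are reversed below.\<close>
    have ts: "Fun g ts \<in> K" using K_inherits_star step(1) a by blast
    have "boxed \<Delta> K V (\<lambda>\<sigma>. \<forall>i \<in> {..<rank \<Delta> g}. related \<Delta> (opposite (var \<Delta> g i)) (subst \<sigma> (\<rho>s ! i)) (ts ! i))"
    proof (rule boxed_Ball)
      fix i assume "i \<in> {..<rank \<Delta> g}"
      then have i: "i < rank \<Delta> g" by simp
      have *: "\<rho>s ! i \<in> terms (classes \<Delta>) (rank \<Delta>) V" "ts' ! i = subst \<sigma>\<^sub>0 (\<rho>s ! i)" "ts ! i \<in> K"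
        using \<tau>(1) \<rho> i len K_args[OF ts, of "ts ! i"] by (simp_all add: terms_Fun_iff)
      show "boxed \<Delta> K V (\<lambda>\<sigma>. related \<Delta> (opposite (var \<Delta> g i)) (subst \<sigma> (\<rho>s ! i)) (ts ! i))"
      proof (cases "var \<Delta> g i")
        case Invariant
        then have "ts ! i = subst \<sigma>\<^sub>0 (\<rho>s ! i)" using step(4)[OF i] * by (simp add: related_def)
        then show ?thesis using boxed_eq[OF *(1), of \<sigma>\<^sub>0] *(3) Invariant by (simp add: related_def)
      next
        case Covariant
        show ?thesis
          using step(5)[OF i Covariant, THEN conjunct2, rule_format, OF *] Covariant by simp
      next
        case Contravariant
        show ?thesis
          using step(6)[OF i Contravariant, THEN conjunct1, rule_format, OF *] Contravariant by simp
      qed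
    qed
    then show ?thesis
    proof (rule boxed_cong)
      fix \<sigma> assume \<sigma>: "\<And>x. x \<in> V \<Longrightarrow> \<sigma> x \<in> ground_types \<Delta>"
      have len': "length \<rho>s = rank \<Delta> g" using \<rho> len by simp
      have "Fun g (map (subst \<sigma>) \<rho>s) \<in> ground_types \<Delta>"
        using ground_types_subst[OF \<tau>(1) \<sigma>] \<rho>(1) by simp
      moreover have "t \<in> ground_types \<Delta>" using a K_ground by blast
      ultimately show "related \<Delta> Contravariant (subst \<sigma> \<tau>) t \<longleftrightarrow>
        (\<forall>i \<in> {..<rank \<Delta> g}. related \<Delta> (opposite (var \<Delta> g i)) (subst \<sigma> (\<rho>s ! i)) (ts ! i))"
        using subtype_iff_related[OF step(1) _ step(2), of "map (subst \<sigma>) \<rho>s"] len' \<rho>(1)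
        by (simp add: related_def[of _ Contravariant] related_opposite Ball_def)
    qed
  qed
  show ?case by (intro conjI allI impI) (erule (2) sub, erule (2) super)
qed

lemma boxed_related:
  assumes "\<tau> \<in> terms (classes \<Delta>) (rank \<Delta>) V" "related \<Delta> v (subst \<sigma>\<^sub>0 \<tau>) s" "s \<in> K"
  shows "boxed \<Delta> K V (\<lambda>\<sigma>. related \<Delta> v (subst \<sigma> \<tau>) s)"
proof (cases v)
  case Invariant
  then show ?thesis using boxed_eq[of \<tau> V \<sigma>\<^sub>0] assms by (auto simp: related_def)
next
  case Covariant
  then show ?thesis using boxed_subtype[of "subst \<sigma>\<^sub>0 \<tau>" s V] assms by (auto simp: related_def)
next
  case Contravariant
  then show ?thesis using boxed_subtype[of s "subst \<sigma>\<^sub>0 \<tau>" V] assms by (auto simp: related_def)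
qed

text \<open>This yields the production for state \<open>Q\<close> and symbol \<open>g\<close>, with
  \<open>Qs\<close> the states of the arguments. The satisfying instance
  \<open>Fun g ts\<^sub>0\<close> serves as the witness for \<open>boxed_related\<close>.\<close>

lemma satisfies_Fun:
  assumes "Q \<subseteq> UNIV \<times> K" "Fun g ts\<^sub>0 \<in> ground_types \<Delta>" "satisfies \<Delta> (Fun g ts\<^sub>0) Q"
  shows "\<exists>Qs. length Qs = rank \<Delta> g \<and> set Qs \<subseteq> Pow (UNIV \<times> K) \<and>
    (\<forall>ts. Fun g ts \<in> ground_types \<Delta> \<longrightarrow>
      (satisfies \<Delta> (Fun g ts) Q \<longleftrightarrow> (\<forall>i < rank \<Delta> g. satisfies \<Delta> (ts ! i) (Qs ! i))))"
proof -
  let ?n = "rank \<Delta> g"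
  \<comment> \<open>Variables are named by argument positions, so \<open>(!) ts\<close> is the
    substitution that turns this term into \<open>Fun g ts\<close>.\<close>
  let ?\<tau> = "Fun g (map Var [0..<?n])"
  have \<tau>: "?\<tau> \<in> terms (classes \<Delta>) (rank \<Delta>) {..<?n}"
    using assms(2) by (auto simp: ground_types_Fun_iff terms_Fun_iff terms_Var_iff)
  have sub: "subst ((!) ts) ?\<tau> = Fun g ts" if "length ts = ?n" for ts
    using that by (auto simp: comp_def intro: nth_equalityI)
  have len: "length ts\<^sub>0 = ?n" using assms(2) by (simp add: ground_types_Fun_iff)
  have "boxed \<Delta> K {..<?n} (\<lambda>\<sigma>. \<forall>c \<in> Q. related \<Delta> (fst c) (subst \<sigma> ?\<tau>) (snd c))"
    using assms(1,3) sub[OF len]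
    by (intro boxed_Ball boxed_related[OF \<tau>, of _ "(!) ts\<^sub>0"]) (auto simp: satisfies_def)
  then obtain R where R: "\<And>x. R x \<subseteq> UNIV \<times> K"
    "\<And>\<sigma>. (\<forall>x \<in> {..<?n}. \<sigma> x \<in> ground_types \<Delta>) \<Longrightarrow>
      (\<forall>c \<in> Q. related \<Delta> (fst c) (subst \<sigma> ?\<tau>) (snd c)) \<longleftrightarrow> (\<forall>x \<in> {..<?n}. satisfies \<Delta> (\<sigma> x) (R x))"
    unfolding boxed_def by blast
  have "satisfies \<Delta> (Fun g ts) Q \<longleftrightarrow> (\<forall>i < ?n. satisfies \<Delta> (ts ! i) (R i))"
    if "Fun g ts \<in> ground_types \<Delta>" for ts
  proof -
    have "length ts = ?n" "\<forall>x \<in> {..<?n}. ts ! x \<in> ground_types \<Delta>"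
      using that by (auto simp: ground_types_Fun_iff)
    then show ?thesis using R(2)[of "(!) ts"] sub[of ts] by (auto simp: satisfies_def)
  qed
  then show ?thesis using R(1) by (intro exI[of _ "map R [0..<?n]"]) auto
qed

end

end

end

section \<open>Derivations of a grammar\<close>

lemma derives_Fun_left:
  assumes "(derives G)\<^sup>*\<^sup>* (Fun f us) t"
  shows "\<exists>ts. t = Fun f ts \<and> list_all2 ((derives G)\<^sup>*\<^sup>*) us ts"
  using assms
proof (induction rule: rtranclp_induct)
  case base
  then show ?case by (simp add: list_all2_refl)
next
  case (step t t')
  then obtain ts where ts: "t = Fun f ts" "list_all2 ((derives G)\<^sup>*\<^sup>*) us ts" by blast
  from step(2) obtain ls s s' rs where s: "ts = ls @ s # rs" "t' = Fun f (ls @ s' # rs)"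
    "derives G s s'"
    unfolding ts(1) by (auto elim: derives.cases)
  have "list_all2 ((derives G)\<^sup>*\<^sup>*) ts (ls @ s' # rs)"
    unfolding s(1) using s(3) by (intro list_all2_appendI list.rel_intros list_all2_refl) auto
  with ts(2) have "list_all2 ((derives G)\<^sup>*\<^sup>*) us (ls @ s' # rs)"
    by (rule list_all2_trans[rotated]) auto
  then show ?case using s(2) by blast
qed

lemma derives_star_inner:
  "(derives G)\<^sup>*\<^sup>* t t' \<Longrightarrow> (derives G)\<^sup>*\<^sup>* (Fun f (ls @ t # rs)) (Fun f (ls @ t' # rs))"
  by (induction rule: rtranclp_induct) (auto intro: derives_inner rtranclp.rtrancl_into_rtrancl)

text \<open>The prefix \<open>ls\<close> holds the arguments already rewritten; the induction moves
  from left to right.\<close>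

lemma derives_Fun_right:
  assumes "list_all2 ((derives G)\<^sup>*\<^sup>*) us ts"
  shows "(derives G)\<^sup>*\<^sup>* (Fun f (ls @ us)) (Fun f (ls @ ts))"
  using assms
proof (induction arbitrary: ls rule: list_all2_induct)
  case (Cons u us t ts)
  then show ?case using derives_star_inner[of G u t f ls us] Cons(3)[of "ls @ [t]"]
    by (auto intro: rtranclp_trans)
qed simp

text \<open>Turns derivations into a recursion on the derived tree, the form in which both
  translations compare them with subtyping.\<close>

lemma derives_Var_Fun_iff:
  "(derives G)\<^sup>*\<^sup>* (Var v) (Fun f ts) \<longleftrightarrow>
    (\<exists>vs. (v, f, vs) \<in> productions G \<and> list_all2 (\<lambda>w t. (derives G)\<^sup>*\<^sup>* (Var w) t) vs ts)"
proof
  assume "(derives G)\<^sup>*\<^sup>* (Var v) (Fun f ts)"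
  then obtain t where "derives G (Var v) t" "(derives G)\<^sup>*\<^sup>* t (Fun f ts)"
    by (metis converse_rtranclpE trm.distinct(1))
  then show "\<exists>vs. (v, f, vs) \<in> productions G \<and> list_all2 (\<lambda>w t. (derives G)\<^sup>*\<^sup>* (Var w) t) vs ts"
    by (auto elim!: derives.cases dest!: derives_Fun_left simp: list_all2_map1)
next
  assume "\<exists>vs. (v, f, vs) \<in> productions G \<and> list_all2 (\<lambda>w t. (derives G)\<^sup>*\<^sup>* (Var w) t) vs ts"
  then obtain vs where vs: "(v, f, vs) \<in> productions G"
    "list_all2 ((derives G)\<^sup>*\<^sup>*) (map Var vs) ts"
    by (auto simp: list_all2_map1)
  then show "(derives G)\<^sup>*\<^sup>* (Var v) (Fun f ts)"
    using derives_Fun_right[OF vs(2), of f "[]"]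
    by (auto intro: converse_rtranclp_into_rtranclp derives_root)
qed

section \<open>From class tables to grammars\<close>

lemma cl_ground:
  assumes "class_table \<Delta>" "T \<subseteq> ground_types \<Delta>"
  shows "cl \<Delta> T \<subseteq> ground_types \<Delta>"
proof
  fix t assume "t \<in> cl \<Delta> T"
  then show "t \<in> ground_types \<Delta>"
    by induction (use assms in \<open>auto simp: ground_types_Fun_iff intro: inherits_ground\<close>)
qed

lemma finite_variance: "finite (UNIV :: variance set)"
proof -
  have "(UNIV :: variance set) = {Invariant, Covariant, Contravariant}"
    using variance.exhaust by auto
  then show ?thesis by (metis finite.emptyI finite.insertI)
qed

lemma subtype_language_DRF:
  fixes \<Delta> :: "'a class_table"
  assumes "conforms {Contravariance} \<Delta>" "t\<^sub>0 \<in> ground_types \<Delta>" "A \<subseteq> classes \<Delta>"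
  shows "subtype_language \<Delta> t\<^sub>0 A \<in> DRF"
proof -
  have ct: "class_table \<Delta>" and acyc: "acyclic_inheritance \<Delta>" and single: "single_instantiation \<Delta>"
    and "non_expansive \<Delta>"
    using assms(1) by (auto simp: conforms_def well_formed_def)
  define K where "K = cl \<Delta> {t\<^sub>0}"
  have "finite K" using \<open>non_expansive \<Delta>\<close> assms(2) by (simp add: non_expansive_def K_def)
  have K_ground: "K \<subseteq> ground_types \<Delta>" unfolding K_def using cl_ground[OF ct] assms(2) by simp
  have K_args: "\<And>g ts t. Fun g ts \<in> K \<Longrightarrow> t \<in> set ts \<Longrightarrow> t \<in> K"
    and K_inherits: "\<And>t t'. t \<in> K \<Longrightarrow> inherits \<Delta> t t' \<Longrightarrow> t' \<in> K"
    unfolding K_def by (auto intro: cl_decomposition cl_inheritance)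
  define S where "S = Pow ((UNIV :: variance set) \<times> K)"
  have "finite S" unfolding S_def using \<open>finite K\<close> finite_variance by simp
  \<comment> \<open>Grammar variables are natural numbers, so the finitely many constraint sets are
    numbered injectively.\<close>
  then obtain e :: "(variance \<times> 'a trm) set \<Rightarrow> nat" where e: "inj_on e S"
    using finite_imp_inj_to_nat_seg by blast
  define feasible where "feasible Q g Qs \<longleftrightarrow> length Qs = rank \<Delta> g \<and> set Qs \<subseteq> S \<and>
    (\<forall>ts. Fun g ts \<in> ground_types \<Delta> \<longrightarrow>
      (satisfies \<Delta> (Fun g ts) Q \<longleftrightarrow> (\<forall>i < rank \<Delta> g. satisfies \<Delta> (ts ! i) (Qs ! i))))" for Q g Qs
  \<comment> \<open>One list is fixed for each state and symbol, which gives determinism. The choice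
    is arbitrary when no list is feasible; \<open>P\<close> below filters such cases out.\<close>
  define ch where "ch Q g = (SOME Qs. feasible Q g Qs)" for Q g
  have ch: "feasible Q g (ch Q g)"
    if "Q \<in> S" "Fun g ts \<in> ground_types \<Delta>" "satisfies \<Delta> (Fun g ts) Q" for Q g ts
  proof -
    have "\<exists>Qs. feasible Q g Qs"
      unfolding feasible_def S_def
    proof (rule satisfies_Fun[OF ct acyc single K_ground])
      show "t \<in> K" if "Fun h us \<in> K" "t \<in> set us" for h us t using K_args that by blast
      show "t' \<in> K" if "t \<in> K" "inherits \<Delta> t t'" for t t' using K_inherits that by blast
      show "Q \<subseteq> UNIV \<times> K" using that(1) by (simp add: S_def)
    qed (fact that)+
    then show ?thesis unfolding ch_def by (rule someI_ex)
  qed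
  define P where "P = {(e Q, g, map e (ch Q g)) | Q g. Q \<in> S \<and> g \<in> A \<and> feasible Q g (ch Q g)}"
  \<comment> \<open>The start state demands that a tree be a supertype of \<open>t\<^sub>0\<close>:
    for \<open>Contravariant\<close>, \<open>related\<close> puts the bound on the left.\<close>
  define G where "G = \<lparr>symbols = A, symbol_rank = rank \<Delta>, variables = e ` S,
    start = e {(Contravariant, t\<^sub>0)}, productions = P\<rparr>"
  have "finite A" using assms(3) ct finite_subset by (auto simp: class_table_def)
  have "t\<^sub>0 \<in> K" unfolding K_def by (simp add: cl_base)
  then have S0: "{(Contravariant, t\<^sub>0)} \<in> S" by (simp add: S_def)
  have "P \<subseteq> (\<lambda>(Q, g). (e Q, g, map e (ch Q g))) ` (S \<times> A)" by (auto simp: P_def)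
  then have "finite P" using \<open>finite S\<close> \<open>finite A\<close> finite_subset by blast
  moreover have "v \<in> e ` S \<and> f \<in> A \<and> length vs = rank \<Delta> f \<and> set vs \<subseteq> e ` S"
    if "(v, f, vs) \<in> P" for v f vs
  proof -
    from that obtain Q where Q: "Q \<in> S" "f \<in> A" "feasible Q f (ch Q f)" "v = e Q"
      "vs = map e (ch Q f)"
      unfolding P_def by blast
    from Q(3) have "length (ch Q f) = rank \<Delta> f" "set (ch Q f) \<subseteq> S"
      by (simp_all add: feasible_def)
    then show ?thesis using Q(1,2,4,5) by auto
  qed
  then have "\<forall>(v, f, vs) \<in> P. v \<in> e ` S \<and> f \<in> A \<and> length vs = rank \<Delta> f \<and> set vs \<subseteq> e ` S"
    by blast
  ultimately have rtg: "regular_tree_grammar G"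
    using \<open>finite S\<close> \<open>finite A\<close> S0 by (simp add: regular_tree_grammar_def G_def)
  \<comment> \<open>Injectivity of \<open>e\<close> on \<open>S\<close> recovers the state from the
    left-hand side, and \<open>ch\<close> then fixes the right-hand side.\<close>
  have det: "deterministic G"
    using e by (auto simp: deterministic_def G_def P_def inj_on_def)
  have main: "(derives G)\<^sup>*\<^sup>* (Var (e Q)) t \<longleftrightarrow> satisfies \<Delta> t Q"
    if "t \<in> ground_terms A (rank \<Delta>)" "Q \<in> S" for t Q
    using that
  proof (induction arbitrary: Q)
    case (terms_Fun f ts)
    have "Fun f ts \<in> ground_terms A (rank \<Delta>)" using terms_Fun(1-3) by (rule terms.terms_Fun)
    then have gr: "Fun f ts \<in> ground_types \<Delta>"
      unfolding ground_types_def using assms(3) by (rule terms_mono) simp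
    have args: "list_all2 (\<lambda>w t. (derives G)\<^sup>*\<^sup>* (Var w) t) (map e (ch Q f)) ts \<longleftrightarrow> satisfies \<Delta> (Fun f ts) Q"
      if "feasible Q f (ch Q f)"
    proof -
      have *: "length (ch Q f) = rank \<Delta> f" "set (ch Q f) \<subseteq> S"
        "satisfies \<Delta> (Fun f ts) Q \<longleftrightarrow> (\<forall>i < rank \<Delta> f. satisfies \<Delta> (ts ! i) (ch Q f ! i))"
        using that gr by (auto simp: feasible_def)
      have "(derives G)\<^sup>*\<^sup>* (Var (e (ch Q f ! i))) (ts ! i) \<longleftrightarrow> satisfies \<Delta> (ts ! i) (ch Q f ! i)"
        if "i < rank \<Delta> f" for i
      proof (rule terms_Fun(4))
        show "ts ! i \<in> set ts" using that terms_Fun(2) by simp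
        show "ch Q f ! i \<in> S" using that *(1,2) nth_mem[of i "ch Q f"] by auto
      qed
      then show ?thesis using * terms_Fun(2) by (simp add: list_all2_conv_all_nth)
    qed
    have P_iff: "(e Q, f, vs) \<in> P \<longleftrightarrow> vs = map e (ch Q f) \<and> feasible Q f (ch Q f)" for vs
    proof
      assume "(e Q, f, vs) \<in> P"
      then obtain Q' where "Q' \<in> S" "e Q' = e Q" "vs = map e (ch Q' f)" "feasible Q' f (ch Q' f)"
        unfolding P_def by auto
      then show "vs = map e (ch Q f) \<and> feasible Q f (ch Q f)"
        using inj_onD[OF e, of Q' Q] \<open>Q \<in> S\<close> by auto
    next
      assume "vs = map e (ch Q f) \<and> feasible Q f (ch Q f)"
      then show "(e Q, f, vs) \<in> P"
        unfolding P_def using terms_Fun(1) \<open>Q \<in> S\<close> by blast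
    qed
    have "productions G = P" by (simp add: G_def)
    \<comment> \<open>If the tree satisfies \<open>Q\<close>, then \<open>ch\<close> gives
      feasibility and thus the production. Conversely a production carries feasibility, under which
      \<open>args\<close> is the equivalence.\<close>
    then show ?case
      unfolding derives_Var_Fun_iff using args P_iff ch[OF \<open>Q \<in> S\<close> gr] by auto
  qed simp
  have "subtype_language \<Delta> t\<^sub>0 A = grammar_language G"
    using main[OF _ S0]
    by (auto simp: subtype_language_def grammar_language_def G_def satisfies_def related_def)
  then show ?thesis using rtg det by (auto simp: DRF_def)
qed

section \<open>From grammars to class tables\<close>

lemma subst_ground: "t \<in> ground_terms A rk \<Longrightarrow> subst \<sigma> t = t"
  by (induction rule: terms.induct) (auto intro: map_idI)

primrec subterms :: "'a trm \<Rightarrow> 'a trm set" where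
  "subterms (Var x) = {Var x}"
| "subterms (Fun f ts) = insert (Fun f ts) (\<Union>(set (map subterms ts)))"

lemma subterms_refl: "t \<in> subterms t"
  by (cases t) auto

lemma finite_subterms: "finite (subterms t)"
  by (induction t) auto

lemma subterms_arg: "Fun f ts \<in> subterms s \<Longrightarrow> t \<in> set ts \<Longrightarrow> t \<in> subterms s"
  by (induction s) (auto intro: subterms_refl)

text \<open>Ground supertypes are unchanged by instantiation, so inheritance leads only to declared
  supertypes. The closure thus lies within the subterms of \<open>T\<close> and of these finitely
  many types.\<close>

lemma non_expansive_ground_supers:
  fixes \<Delta> :: "'a class_table"
  assumes "finite (classes \<Delta>)"
    "\<And>g \<tau>. g \<in> classes \<Delta> \<Longrightarrow> \<tau> \<in> set (supers \<Delta> g) \<Longrightarrow> \<tau> \<in> ground_types \<Delta>"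
  shows "non_expansive \<Delta>"
  unfolding non_expansive_def
proof (intro allI impI)
  fix T :: "'a trm set" assume "finite T"
  define W where "W = T \<union> (\<Union>g \<in> classes \<Delta>. set (supers \<Delta> g))"
  have "t \<in> (\<Union>s \<in> W. subterms s)" if "t \<in> cl \<Delta> T" for t
    using that
  proof induction
    case (cl_base t)
    then show ?case using subterms_refl by (auto simp: W_def)
  next
    case (cl_decomposition g ts t)
    then show ?case using subterms_arg by fast
  next
    case (cl_inheritance t t')
    from cl_inheritance(2) have "t' \<in> W"
      by (cases rule: inherits.cases)
        (use assms(2) subst_ground in \<open>fastforce simp: W_def ground_types_def terms_Fun_iff\<close>)
    then show ?case using subterms_refl by blast
  qed
  moreover have "finite (\<Union>s \<in> W. subterms s)"
    using \<open>finite T\<close> assms(1) by (auto simp: W_def finite_subterms)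
  ultimately show "finite (cl \<Delta> T)" by (meson finite_subset subsetI)
qed

lemma grammar_language_in_languages:
  fixes G :: "'a::infinite grammar"
  assumes rtg: "regular_tree_grammar G" and det: "deterministic G"
  shows "grammar_language G \<in> languages {}"
proof -
  let ?S = "symbols G" and ?rk = "symbol_rank G" and ?P = "productions G"
  have fin: "finite ?S" "finite (variables G)" "finite ?P" and start: "start G \<in> variables G"
    and P: "\<And>v f vs. (v, f, vs) \<in> ?P \<Longrightarrow>
      v \<in> variables G \<and> f \<in> ?S \<and> length vs = ?rk f \<and> set vs \<subseteq> variables G"
    using rtg by (auto simp: regular_tree_grammar_def)
  \<comment> \<open>Grammar variables become class names; the infinite name type has room for them
    outside the finite alphabet.\<close>
  have "infinite (- ?S)" using fin(1) infinite_UNIV by simp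
  then obtain e :: "nat \<Rightarrow> 'a" where e: "inj e" and e_fresh: "\<And>v. e v \<notin> ?S"
    using infinite_countable_subset[of "- ?S"] by auto
  define c where "c v = Fun (e v) []" for v
  \<comment> \<open>Supertypes are declared as lists, so for each class the finite set of right-hand
    sides has to be enumerated. For a symbol this set is empty, as \<open>e\<close> avoids the
    alphabet.\<close>
  have "\<exists>sup. \<forall>a. set (sup a) = {Fun f (map c vs) | v f vs. (v, f, vs) \<in> ?P \<and> a = e v}"
  proof (intro choice allI finite_list)
    fix a
    have "{Fun f (map c vs) | v f vs. (v, f, vs) \<in> ?P \<and> a = e v}
        \<subseteq> (\<lambda>(v, f, vs). Fun f (map c vs)) ` ?P" by force
    then show "finite {Fun f (map c vs) | v f vs. (v, f, vs) \<in> ?P \<and> a = e v}"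
      using fin(3) finite_subset by blast
  qed
  then obtain sup where
    sup: "\<And>a. set (sup a) = {Fun f (map c vs) | v f vs. (v, f, vs) \<in> ?P \<and> a = e v}"
    by blast
  define \<Delta> where "\<Delta> = \<lparr>classes = ?S \<union> e ` variables G,
    params = (\<lambda>a. if a \<in> ?S then map (Pair Covariant) [0..<?rk a] else []), supers = sup\<rparr>"
  have classes: "classes \<Delta> = ?S \<union> e ` variables G" and supers: "supers \<Delta> = sup"
    by (simp_all add: \<Delta>_def)
  have rank_S: "rank \<Delta> f = ?rk f" if "f \<in> ?S" for f
    using that by (simp add: rank_def \<Delta>_def)
  have rank_e: "rank \<Delta> (e v) = 0" for v
    using e_fresh by (simp add: rank_def \<Delta>_def)
  have var: "var \<Delta> g i = Covariant" if "i < rank \<Delta> g" for g i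
    using that by (auto simp: rank_def \<Delta>_def var_def split: if_splits)
  have distinct: "distinct (param_names \<Delta> g)" for g
    by (auto simp: param_names_def \<Delta>_def comp_def)
  have c_ground: "c v \<in> ground_types \<Delta>" if "v \<in> variables G" for v
    using that by (auto simp: c_def ground_types_Fun_iff classes rank_e)
  have rhs_ground: "Fun f (map c vs) \<in> ground_types \<Delta>" if "(v, f, vs) \<in> ?P" for v f vs
    using P[OF that] c_ground by (auto simp: ground_types_Fun_iff classes rank_S)
  have supers_ground: "\<tau> \<in> ground_types \<Delta>" if "\<tau> \<in> set (sup g)" for \<tau> g
    using that rhs_ground by (auto simp: sup)
  have ct: "class_table \<Delta>"
    unfolding class_table_def
  proof (intro conjI ballI)
    show "finite (classes \<Delta>)" using fin by (simp add: classes)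
  next
    fix g \<tau> assume "\<tau> \<in> set (supers \<Delta> g)"
    then have \<tau>: "\<tau> \<in> ground_types \<Delta>" using supers_ground supers by simp
    \<comment> \<open>A ground term is fixed by every substitution; substituting \<open>Var\<close>
      only moves it from the empty variable set to the declared parameters.\<close>
    have "subst Var \<tau> \<in> terms (classes \<Delta>) (rank \<Delta>) (set (param_names \<Delta> g))"
      using \<tau> by (intro subst_in_terms) (auto simp: ground_types_def)
    then show "\<tau> \<in> terms (classes \<Delta>) (rank \<Delta>) (set (param_names \<Delta> g))"
      using \<tau> subst_ground unfolding ground_types_def by metis
    show "\<forall>x. \<tau> \<noteq> Var x" using \<tau> ground_types_not_Var by metis
  qed (rule distinct)
  have inherits_iff: "inherits \<Delta> t t' \<longleftrightarrow>
      (\<exists>v f vs. (v, f, vs) \<in> ?P \<and> t = c v \<and> t' = Fun f (map c vs))" for t t'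
  proof
    assume "inherits \<Delta> t t'"
    then obtain g ts \<tau> where *: "t = Fun g ts" "t \<in> ground_types \<Delta>" "\<tau> \<in> set (sup g)"
      "t' = subst (assign (param_names \<Delta> g) ts) \<tau>"
      by (auto elim!: inherits.cases simp: supers)
    have "t' = \<tau>"
      using *(4) supers_ground[OF *(3)] subst_ground unfolding ground_types_def by metis
    moreover obtain v f vs where "(v, f, vs) \<in> ?P" "\<tau> = Fun f (map c vs)" "g = e v"
      using *(3) by (auto simp: sup)
    moreover have "t = c v"
      using *(1,2) \<open>g = e v\<close> rank_e[of v] by (simp add: c_def ground_types_Fun_iff)
    ultimately show "\<exists>v f vs. (v, f, vs) \<in> ?P \<and> t = c v \<and> t' = Fun f (map c vs)"
      by blast
  next
    assume "\<exists>v f vs. (v, f, vs) \<in> ?P \<and> t = c v \<and> t' = Fun f (map c vs)"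
    then obtain v f vs where *: "(v, f, vs) \<in> ?P" "t = c v" "t' = Fun f (map c vs)" by blast
    have "subst (assign (param_names \<Delta> (e v)) []) t' = t'"
      using rhs_ground[OF *(1)] *(3) subst_ground unfolding ground_types_def by metis
    moreover have "t' \<in> set (supers \<Delta> (e v))" using * by (auto simp: supers sup)
    ultimately show "inherits \<Delta> t t'"
      using inherits.intros[of "e v" "[]" \<Delta> t'] c_ground[of v] P[OF *(1)] *(2) by (simp add: c_def)
  qed
  \<comment> \<open>Every supertype has an alphabet symbol at its root, and such classes have no
    supertypes; a chain therefore never has a second step.\<close>
  have inherits_plus: "inherits \<Delta> t t'" if "(inherits \<Delta>)\<^sup>+\<^sup>+ t t'" for t t'
    using that
  proof induction
    case (step t' t'')
    then show ?case using P e_fresh by (fastforce simp: inherits_iff c_def)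
  qed
  have wf: "well_formed \<Delta>"
    unfolding well_formed_def
  proof (intro conjI ballI ct)
    show "acyclic_inheritance \<Delta>"
      unfolding acyclic_inheritance_def
      using P e_fresh by (fastforce dest!: inherits_plus simp: inherits_iff c_def)
  next
    fix g \<tau> assume "\<tau> \<in> set (supers \<Delta> g)"
    then obtain v f vs where "(v, f, vs) \<in> ?P" "\<tau> = Fun f (map c vs)"
      by (auto simp: supers sup)
    then show "valid_variance \<Delta> (params \<Delta> g) \<tau>"
      using P[of v f vs] by (auto simp: var rank_S c_def)
  qed
  have plus: "\<exists>v f vs. (v, f, vs) \<in> ?P \<and> g = e v \<and> \<tau> = Fun f (map c vs)"
    if "class_inherits_plus \<Delta> g \<tau>" for g \<tau>
    using that
  proof cases
    case (1 g' \<tau>s \<tau>')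
    from 1(3) obtain v vs where v: "(v, g', vs) \<in> ?P" "g = e v" "\<tau>s = map c vs"
      by (auto simp: supers sup)
    have "set (supers \<Delta> g') = {}"
      using P[OF v(1)] e_fresh by (auto simp: supers sup)
    with 1(4) have "\<tau>' = Fun g' (map Var (param_names \<Delta> g'))"
      by cases auto
    moreover have "map (assign (param_names \<Delta> g') \<tau>s) (param_names \<Delta> g') = \<tau>s"
      using distinct P[OF v(1)] v(3) by (intro map_assign) (auto simp: rank_S)
    ultimately have "\<tau> = Fun g' \<tau>s" using 1(1) by (simp add: comp_def)
    then show ?thesis using v by blast
  qed
  \<comment> \<open>Determinism of the grammar enters here: one variable and one symbol admit a
    single right-hand side.\<close>
  have "single_instantiation \<Delta>"
    unfolding single_instantiation_def
  proof (intro allI impI)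
    fix g g' \<tau>s \<tau>s'
    assume "class_inherits_plus \<Delta> g (Fun g' \<tau>s)" "class_inherits_plus \<Delta> g (Fun g' \<tau>s')"
    from plus[OF this(1)] plus[OF this(2)] show "\<tau>s = \<tau>s'"
      using det injD[OF e] unfolding deterministic_def by (metis trm.inject(2))
  qed
  moreover have "no_contravariance \<Delta>" by (simp add: no_contravariance_def var)
  moreover have "non_expansive \<Delta>"
    using fin supers_ground by (intro non_expansive_ground_supers) (auto simp: classes supers)
  ultimately have "conforms {} \<Delta>" using wf by (simp add: conforms_def)
  have main: "(derives G)\<^sup>*\<^sup>* (Var v) t \<longleftrightarrow> subtype \<Delta> (c v) t"
    if "t \<in> ground_terms ?S ?rk" for t v
    using that
  proof (induction arbitrary: v)
    case (terms_Fun f ts)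
    have gr: "Fun f ts \<in> ground_types \<Delta>"
      using terms_mono[OF terms.terms_Fun[OF terms_Fun(1-3)], of "classes \<Delta>" "rank \<Delta>"]
      by (simp add: ground_types_def classes rank_S)
    have "subtype \<Delta> (c v) (Fun f ts) \<longleftrightarrow>
      (\<exists>vs. (v, f, vs) \<in> ?P \<and> list_all2 (\<lambda>w t. subtype \<Delta> (c w) t) vs ts)"
    proof
      assume "subtype \<Delta> (c v) (Fun f ts)"
      then obtain us where us: "(inherits \<Delta>)\<^sup>*\<^sup>* (c v) (Fun f us)"
        "\<And>i. i < rank \<Delta> f \<Longrightarrow> related \<Delta> (var \<Delta> f i) (us ! i) (ts ! i)"
        by (elim subtypeE) auto
      \<comment> \<open>The root \<open>e v\<close> is not in the alphabet, so the chain is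
        nonempty; by \<open>inherits_plus\<close> it is one step, that is, one production.\<close>
      have "c v \<noteq> Fun f us" using e_fresh terms_Fun(1) by (auto simp: c_def)
      then have "inherits \<Delta> (c v) (Fun f us)"
        using us(1) inherits_plus by (auto dest: rtranclpD)
      then obtain vs where vs: "(v, f, vs) \<in> ?P" "us = map c vs"
        using e by (auto simp: inherits_iff c_def inj_eq)
      then have "list_all2 (\<lambda>w t. subtype \<Delta> (c w) t) vs ts"
        using us(2) P[OF vs(1)] terms_Fun(1,2)
        by (auto simp: list_all2_conv_all_nth var rank_S related_def)
      then show "\<exists>vs. (v, f, vs) \<in> ?P \<and> list_all2 (\<lambda>w t. subtype \<Delta> (c w) t) vs ts"
        using vs by blast
    next
      assume "\<exists>vs. (v, f, vs) \<in> ?P \<and> list_all2 (\<lambda>w t. subtype \<Delta> (c w) t) vs ts"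
      then obtain vs where vs: "(v, f, vs) \<in> ?P" "list_all2 (\<lambda>w t. subtype \<Delta> (c w) t) vs ts"
        by blast
      have "subtype \<Delta> (Fun f (map c vs)) (Fun f ts)"
        using vs(2) P[OF vs(1)] rhs_ground[OF vs(1)] gr
        by (intro subtype_Fun) (auto simp: var rank_S related_def list_all2_conv_all_nth)
      moreover have "inherits \<Delta> (c v) (Fun f (map c vs))"
        using vs(1) inherits_iff by blast
      ultimately show "subtype \<Delta> (c v) (Fun f ts)" by (rule subtype_Super[rotated])
    qed
    moreover have "list_all2 (\<lambda>w t. (derives G)\<^sup>*\<^sup>* (Var w) t) vs ts \<longleftrightarrow>
      list_all2 (\<lambda>w t. subtype \<Delta> (c w) t) vs ts" for vs
      using terms_Fun(4) by (auto simp: list_all2_conv_all_nth)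
    ultimately show ?case unfolding derives_Var_Fun_iff by simp
  qed simp
  have "ground_terms ?S (rank \<Delta>) = ground_terms ?S ?rk"
    by (intro equalityI subsetI; erule terms_mono) (auto simp: rank_S)
  then have "grammar_language G = subtype_language \<Delta> (c (start G)) ?S"
    using main by (auto simp: grammar_language_def subtype_language_def)
  moreover have "?S \<subseteq> classes \<Delta>" by (simp add: classes)
  ultimately show ?thesis
    using \<open>conforms {} \<Delta>\<close> c_ground[OF start] unfolding languages_def by blast
qed

theorem proposition5p4:
  "(languages {} :: 'a::infinite forest set) = languages {Contravariance} \<and>
   languages {Contravariance} = (DRF :: 'a forest set)"
proof -
  \<comment> \<open>Forbidding contravariance only adds a condition on class tables. The three
    inclusions then close a cycle.\<close>
  have "(languages {} :: 'a forest set) \<subseteq> languages {Contravariance}"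
    unfolding languages_def conforms_def by blast
  moreover have "languages {Contravariance} \<subseteq> (DRF :: 'a forest set)"
    using subtype_language_DRF by (auto simp: languages_def)
  moreover have "(DRF :: 'a forest set) \<subseteq> languages {}"
    using grammar_language_in_languages by (auto simp: DRF_def)
  ultimately show ?thesis by blast
qed

end
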